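(* Let $\mathfrak{g}$ be a complex simple Lie algebra of rank $\ell$, $h$ its Coxeter number, $m_1,m_2,\dots,m_\ell$ the exponents of $\mathfrak{g}$, and $C$ its Cartan matrix. Then $$2^{2\ell}\prod_{i=1}^{\ell}\sin^2\frac{m_i\pi}{2h}=\det C.$$
   Context: The Cartan matrix is $C=(c_{ij})_{1\le i,j\le \ell}$ with $c_{ij}=2(\alpha_i,\alpha_j)/(\alpha_j,\alpha_j)$, where $\alpha_1,\dots,\alpha_\ell$ is a basis of simple roots of the root system of $\mathfrak{g}$ with respect to a Cartan subalgebra and $(\cdot,\cdot)$ is induced by the Killing form. The Coxeter number $h$ is the order of a Coxeter element (a product, in any order, of all the simple reflections) of the Weyl group, and the exponents are the integers $1\le m_1\le\dots\le m_\ell\le h-1$ such that the eigenvalues of a Coxeter element, counted with multiplicity, are $e^{2\pi i m_j/h}$. Explicitly (exponents; Coxeter number): $A_n$: $1,2,\dots,n$; $n+1$. $B_n$ and $C_n$: $1,3,5,\dots,2n-1$; $2n$. $D_n$: $1,3,5,\dots,2n-3$ together with $n-1$ (so $n-1$ occurs twice if $n$ is even); $2n-2$. $E_6$: $1,4,5,7,8,11$; $12$. $E_7$: $1,5,7,9,11,13,17$; $18$. $E_8$: $1,7,11,13,17,19,23,29$; $30$. $F_4$: $1,5,7,11$; $12$. $G_2$: $1,5$; $6$. *)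

theory Defs
  imports
    Complex_Main
    "HOL-Library.Function_Algebras"
    "Jordan_Normal_Form.Char_Poly"
begin

definition fun_scale :: "complex \<Rightarrow> ('a \<Rightarrow> complex) \<Rightarrow> 'a \<Rightarrow> complex"
  where "fun_scale c f = (\<lambda>x. c * f x)"

interpretation fun_space: vector_space fun_scale
  by unfold_locales (auto simp: fun_scale_def fun_eq_iff algebra_simps)

locale complex_lie_algebra = vector_space scale
  for scale :: "complex \<Rightarrow> 'g :: ab_group_add \<Rightarrow> 'g" +
  fixes bracket :: "'g \<Rightarrow> 'g \<Rightarrow> 'g"
  assumes finite_dim: "\<exists>B. finite B \<and> span B = UNIV"
    and bracket_add_left: "bracket (x + y) z = bracket x z + bracket y z"
    and bracket_add_right: "bracket x (y + z) = bracket x y + bracket x z"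
    and bracket_scale_left: "bracket (scale c x) y = scale c (bracket x y)"
    and bracket_scale_right: "bracket x (scale c y) = scale c (bracket x y)"
    and bracket_self: "bracket x x = 0"
    and jacobi: "bracket x (bracket y z) + bracket y (bracket z x) + bracket z (bracket x y) = 0"
begin

definition ideal :: "'g set \<Rightarrow> bool"
  where "ideal I \<longleftrightarrow> subspace I \<and> (\<forall>x. \<forall>y\<in>I. bracket x y \<in> I)"

definition subalgebra :: "'g set \<Rightarrow> bool"
  where "subalgebra H \<longleftrightarrow> subspace H \<and> (\<forall>x\<in>H. \<forall>y\<in>H. bracket x y \<in> H)"

definition simple :: bool
  where "simple \<longleftrightarrow> (\<exists>x y. bracket x y \<noteq> 0) \<and> (\<forall>I. ideal I \<longrightarrow> I = {0} \<or> I = UNIV)"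

fun lower_central :: "'g set \<Rightarrow> nat \<Rightarrow> 'g set"
  where
    "lower_central H 0 = H"
  | "lower_central H (Suc n) = span {bracket x y | x y. x \<in> H \<and> y \<in> lower_central H n}"

definition cartan_subalgebra :: "'g set \<Rightarrow> bool"
  where "cartan_subalgebra H \<longleftrightarrow>
    subalgebra H \<and> (\<exists>n. lower_central H n = {0}) \<and> {x. \<forall>y\<in>H. bracket x y \<in> H} = H"

(* The basis extend_basis {} is chosen arbitrarily; the trace does not depend on it. *)
definition trace :: "('g \<Rightarrow> 'g) \<Rightarrow> complex"
  where "trace f = (\<Sum>b\<in>extend_basis {}. representation (extend_basis {}) (f b) b)"

definition killing_form :: "'g \<Rightarrow> 'g \<Rightarrow> complex"
  where "killing_form x y = trace (\<lambda>z. bracket x (bracket y z))"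

(* A linear form on H is represented by the function on the whole space that
   agrees with it on H and is zero outside H. *)
definition dual :: "'g set \<Rightarrow> ('g \<Rightarrow> complex) set"
  where "dual H = {f. (\<forall>x\<in>H. \<forall>y\<in>H. f (x + y) = f x + f y)
    \<and> (\<forall>c. \<forall>x\<in>H. f (scale c x) = c * f x) \<and> (\<forall>x. x \<notin> H \<longrightarrow> f x = 0)}"

(* Plain rather than generalized eigenspaces suffice: both give the same nonzero weights of a
   nilpotent H, by Lie's theorem on each generalized weight space. *)
definition roots :: "'g set \<Rightarrow> ('g \<Rightarrow> complex) set"
  where "roots H = {\<alpha> \<in> dual H. \<alpha> \<noteq> 0 \<and> (\<exists>x. x \<noteq> 0 \<and> (\<forall>y\<in>H. bracket y x = scale (\<alpha> y) x))}"

(* The element of H that corresponds to a linear form under the isomorphism between H and its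
   dual given by the Killing form (which is nondegenerate on H for a simple algebra). *)
definition killing_dual :: "'g set \<Rightarrow> ('g \<Rightarrow> complex) \<Rightarrow> 'g"
  where "killing_dual H \<xi> = (THE t. t \<in> H \<and> (\<forall>x\<in>H. killing_form t x = \<xi> x))"

definition dual_form :: "'g set \<Rightarrow> ('g \<Rightarrow> complex) \<Rightarrow> ('g \<Rightarrow> complex) \<Rightarrow> complex"
  where "dual_form H \<xi> \<mu> = killing_form (killing_dual H \<xi>) (killing_dual H \<mu>)"

(* Indices run over 0, ..., dim H - 1. *)
definition simple_roots :: "'g set \<Rightarrow> (nat \<Rightarrow> 'g \<Rightarrow> complex) \<Rightarrow> bool"
  where "simple_roots H \<alpha> \<longleftrightarrow>
    \<alpha> ` {..<dim H} \<subseteq> roots H \<and> inj_on \<alpha> {..<dim H} \<and>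
    fun_space.independent (\<alpha> ` {..<dim H}) \<and> fun_space.span (\<alpha> ` {..<dim H}) = dual H \<and>
    (\<forall>\<beta>\<in>roots H. \<exists>k :: nat \<Rightarrow> int.
       ((\<forall>i<dim H. k i \<ge> 0) \<or> (\<forall>i<dim H. k i \<le> 0)) \<and>
       \<beta> = (\<Sum>i<dim H. fun_scale (of_int (k i)) (\<alpha> i)))"

definition cartan_matrix :: "'g set \<Rightarrow> (nat \<Rightarrow> 'g \<Rightarrow> complex) \<Rightarrow> complex mat"
  where "cartan_matrix H \<alpha> = mat (dim H) (dim H)
    (\<lambda>(i, j). 2 * dual_form H (\<alpha> i) (\<alpha> j) / dual_form H (\<alpha> j) (\<alpha> j))"

definition reflection :: "'g set \<Rightarrow> ('g \<Rightarrow> complex) \<Rightarrow> ('g \<Rightarrow> complex) \<Rightarrow> ('g \<Rightarrow> complex)"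
  where "reflection H \<alpha> \<xi> = \<xi> - fun_scale (2 * dual_form H \<xi> \<alpha> / dual_form H \<alpha> \<alpha>) \<alpha>"

definition coxeter_element ::
    "'g set \<Rightarrow> (nat \<Rightarrow> 'g \<Rightarrow> complex) \<Rightarrow> (('g \<Rightarrow> complex) \<Rightarrow> ('g \<Rightarrow> complex)) \<Rightarrow> bool"
  where "coxeter_element H \<alpha> c \<longleftrightarrow>
    (\<exists>p. distinct p \<and> set p = {..<dim H} \<and> c = foldr (\<lambda>i f. reflection H (\<alpha> i) \<circ> f) p id)"

definition coxeter_number :: "'g set \<Rightarrow> (nat \<Rightarrow> 'g \<Rightarrow> complex) \<Rightarrow> nat \<Rightarrow> bool"
  where "coxeter_number H \<alpha> h \<longleftrightarrow>
    (\<exists>c. coxeter_element H \<alpha> c \<and> h > 0 \<and> (\<forall>\<xi>\<in>dual H. (c ^^ h) \<xi> = \<xi>) \<and>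
      (\<forall>k. 0 < k \<and> k < h \<longrightarrow> (\<exists>\<xi>\<in>dual H. (c ^^ k) \<xi> \<noteq> \<xi>)))"

(* The matrix, with respect to the simple roots, of an endomorphism of the dual of H. *)
definition simple_root_matrix ::
    "'g set \<Rightarrow> (nat \<Rightarrow> 'g \<Rightarrow> complex) \<Rightarrow> (('g \<Rightarrow> complex) \<Rightarrow> ('g \<Rightarrow> complex)) \<Rightarrow> complex mat"
  where "simple_root_matrix H \<alpha> c = mat (dim H) (dim H)
    (\<lambda>(i, j). fun_space.representation (\<alpha> ` {..<dim H}) (c (\<alpha> j)) (\<alpha> i))"

definition exponents :: "'g set \<Rightarrow> (nat \<Rightarrow> 'g \<Rightarrow> complex) \<Rightarrow> nat \<Rightarrow> (nat \<Rightarrow> nat) \<Rightarrow> bool"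
  where "exponents H \<alpha> h m \<longleftrightarrow>
    (\<forall>i<dim H. 1 \<le> m i \<and> m i < h) \<and> mono_on {..<dim H} m \<and>
    (\<exists>c. coxeter_element H \<alpha> c \<and>
      char_poly (simple_root_matrix H \<alpha> c) =
        (\<Prod>i<dim H. [:- exp (2 * of_real pi * \<i> * of_nat (m i) / of_nat h), 1:]))"

end

end

theory Submission
  imports Defs
begin

text \<open>Let \<open>c\<close> be a Coxeter element. Applying the simple reflections one after the other is a
  Gauss--Seidel sweep, so \<open>U (1 - c) = C\<^sup>T\<close> with \<open>U\<close> unitriangular for the order of the
  reflections; hence \<open>det C = det (1 - c) = \<Prod>(1 - z\<^sub>j)\<close> over the eigenvalues \<open>z\<^sub>j = exp (2 \<pi> \<i> m\<^sub>j / h)\<close>.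
  The Cartan matrix is real, so the exponents are symmetric under \<open>m \<mapsto> h - m\<close>, and with
  \<open>w\<^sub>j = exp (\<pi> \<i> m\<^sub>j / h)\<close> the product becomes
  \<open>\<Prod>(1 - w\<^sub>j) (1 + w\<^sub>j) = \<Prod>\<bar>1 - w\<^sub>j\<bar>\<^sup>2 = \<Prod>4 sin\<^sup>2 (m\<^sub>j \<pi> / 2h)\<close>.

  Only two facts about the Lie algebra are needed: that the Killing form is nondegenerate on \<open>H\<close>
  and that the Cartan matrix is real. Both come from one trace argument: for \<open>t = [x, y]\<close> with
  \<open>x\<close>, \<open>y\<close> in generalized eigenspaces of \<open>ad t\<close> for \<open>a\<close> and \<open>-a\<close>, all eigenvalues of
  \<open>ad t\<close> are real multiples of \<open>a\<close>.\<close>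

section \<open>Generalized eigenspaces and traces\<close>

text \<open>A vanishing trace is a single linear relation between the eigenvalues of
  \<open>bracket t\<close>. It becomes strong once it holds for each set of eigenvalues stable under
  translation by \<open>a\<close>, since half-planes bounded by the line through \<open>a\<close>
  are such sets. Reality of the ratios then serves twice: it turns \<open>killing_form t t\<close>
  into a^2 times a sum of real squares, so that a vanishing Killing form would make every bracket of
  opposite weight vectors act nilpotently; and for \<open>t\<close> proportional to the element dual
  to a root it is the reality of the Cartan entries.

  The structure of \<open>H\<close> is drawn from the basis of simple roots: as it spans
  \<open>dual H\<close>, the roots separate the points of \<open>H\<close>, which forces
  \<open>H\<close> to be abelian. Semisimplicity of the operators \<open>bracket h\<close> is not
  known, so the algebra is decomposed into generalized weight spaces, and only root vectors count as
  genuine eigenvectors.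

  The symmetry of the exponents is needed for the integers themselves: w_j is a square root of z_j
  picked by m_j, and the factor 1 + w for m_j equals 1 - cnj w for h - m_j.\<close>

locale complex_fin_dim = vector_space scale
  for scale :: "complex \<Rightarrow> 'v :: ab_group_add \<Rightarrow> 'v" (infixr "*s" 75) +
  assumes finite_dim: "\<exists>B. finite B \<and> span B = UNIV"
begin

abbreviation endo :: "('v \<Rightarrow> 'v) \<Rightarrow> bool"
  where "endo \<equiv> Vector_Spaces.linear (*s) (*s)"

lemma endoI:
  assumes "\<And>x y. T (x + y) = T x + T y" "\<And>c x. T (c *s x) = c *s T x"
  shows "endo T"
  by (intro Vector_Spaces.linear.intro module_hom.intro module_hom_axioms.intro
      vector_space_axioms module_axioms assms)

lemma endo_module_hom: "endo T \<Longrightarrow> module_hom (*s) (*s) T"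
  by (rule Vector_Spaces.linear.axioms(3))

lemmas endo_add = module_hom.add[OF endo_module_hom]
  and endo_scale = module_hom.scale[OF endo_module_hom]
  and endo_zero = module_hom.zero[OF endo_module_hom]
  and endo_diff = module_hom.diff[OF endo_module_hom]
  and endo_sum = module_hom.sum[OF endo_module_hom]

definition shift :: "('v \<Rightarrow> 'v) \<Rightarrow> complex \<Rightarrow> 'v \<Rightarrow> 'v"
  where "shift T a v = T v - a *s v"

lemma endo_shift: "endo T \<Longrightarrow> endo (shift T a)"
  by (rule endoI) (simp_all add: shift_def endo_add endo_scale algebra_simps scale_right_distrib
      scale_right_diff_distrib)

lemma endo_id: "endo id"
  by (rule endoI) simp_all

lemma endo_comp: "endo S \<Longrightarrow> endo T \<Longrightarrow> endo (\<lambda>x. S (T x))"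
  by (rule endoI) (simp_all add: endo_add endo_scale)

lemma endo_funpow: "endo T \<Longrightarrow> endo (T ^^ n)"
  by (rule endoI; induction n) (simp_all add: endo_add endo_scale)

lemma shift_commute:
  assumes "endo U" "\<And>x. U (T x) = T (U x)"
  shows "shift T a (U x) = U (shift T a x)"
  using assms by (simp add: shift_def endo_diff endo_scale)

definition gen_eigenspace :: "('v \<Rightarrow> 'v) \<Rightarrow> complex \<Rightarrow> 'v set"
  where "gen_eigenspace T a = {v. \<exists>n. (shift T a ^^ n) v = 0}"

lemma gen_eigenspace_step: "shift T a v \<in> gen_eigenspace T a \<Longrightarrow> v \<in> gen_eigenspace T a"
  unfolding gen_eigenspace_def by (auto simp: funpow_swap1 intro: exI[of _ "Suc _"])

lemma gen_eigenspace_zero: "endo T \<Longrightarrow> 0 \<in> gen_eigenspace T a"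
  unfolding gen_eigenspace_def by (auto intro: exI[of _ 0])

lemma gen_eigenspace_shift:
  assumes "endo T" "v \<in> gen_eigenspace T a"
  shows "shift T a v \<in> gen_eigenspace T a"
proof -
  obtain n where "(shift T a ^^ n) v = 0"
    using assms unfolding gen_eigenspace_def by blast
  then have "(shift T a ^^ n) (shift T a v) = 0"
    using endo_zero[OF endo_shift[OF assms(1)]] by (simp add: funpow_swap1[symmetric])
  then show ?thesis unfolding gen_eigenspace_def by blast
qed

text \<open>The chain \<open>v\<close>, \<open>shift T a v\<close>, ... ends in 0, which gives an
  induction on the vector itself. Closure under products and under sums of operators then reduces to
  a one-step identity in place of a binomial expansion of powers.\<close>

lemma gen_eigenspace_induct [consumes 1, case_names zero step]:
  assumes "v \<in> gen_eigenspace T a" "P 0"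
    and "\<And>v. v \<in> gen_eigenspace T a \<Longrightarrow> P (shift T a v) \<Longrightarrow> P v"
  shows "P v"
proof -
  obtain n where "(shift T a ^^ n) v = 0"
    using assms(1) unfolding gen_eigenspace_def by blast
  then show ?thesis
  proof (induction n arbitrary: v)
    case 0
    then show ?case using assms(2) by simp
  next
    case (Suc n)
    then have "(shift T a ^^ n) (shift T a v) = 0" by (simp add: funpow_swap1)
    with Suc show ?case using assms(3) unfolding gen_eigenspace_def by blast
  qed
qed

lemma subspace_gen_eigenspace:
  assumes "endo T"
  shows "subspace (gen_eigenspace T a)"
proof (rule subspaceI)
  let ?S = "shift T a"
  have mono: "(?S ^^ k) x = 0" if "(?S ^^ n) x = 0" "n \<le> k" for k n x
  proof -
    have "(?S ^^ k) x = (?S ^^ (k - n)) ((?S ^^ n) x)"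
      using that(2) by (metis comp_apply funpow_add le_add_diff_inverse2)
    then show ?thesis using that(1) endo_zero[OF endo_funpow[OF endo_shift[OF assms]]] by simp
  qed
  fix x y assume "x \<in> gen_eigenspace T a" "y \<in> gen_eigenspace T a"
  then obtain n k where "(?S ^^ n) x = 0" "(?S ^^ k) y = 0"
    unfolding gen_eigenspace_def by blast
  then have "(?S ^^ max n k) (x + y) = 0"
    using mono by (simp add: endo_add[OF endo_funpow[OF endo_shift[OF assms]]])
  then show "x + y \<in> gen_eigenspace T a" unfolding gen_eigenspace_def by blast
next
  fix c x assume "x \<in> gen_eigenspace T a"
  then show "c *s x \<in> gen_eigenspace T a"
    unfolding gen_eigenspace_def
    using endo_scale[OF endo_funpow[OF endo_shift[OF assms]]] by auto
qed (rule gen_eigenspace_zero[OF assms])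

lemma gen_eigenspace_invariant:
  assumes "endo T" "endo U" "\<And>x. U (T x) = T (U x)" "v \<in> gen_eigenspace T a"
  shows "U v \<in> gen_eigenspace T a"
  using assms(4)
proof (induction rule: gen_eigenspace_induct)
  case zero
  then show ?case using endo_zero[OF assms(2)] gen_eigenspace_zero[OF assms(1)] by simp
next
  case (step v)
  then show ?case
    using shift_commute[of U T a v, OF assms(2,3)] by (metis gen_eigenspace_step)
qed

lemma shift_funpow_eigenvector:
  assumes "endo T" "T v = a *s v"
  shows "(shift T b ^^ n) v = (a - b) ^ n *s v"
proof (induction n)
  case (Suc n)
  then show ?case
    using assms endo_scale[OF endo_shift[OF assms(1)]]
    by (simp add: shift_def scale_left_diff_distrib[symmetric] mult.commute)
qed simp

lemma gen_eigenspace_eigenvector: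
  assumes "endo T" "T v = a *s v" "v \<in> gen_eigenspace T b" "v \<noteq> 0"
  shows "a = b"
  using assms shift_funpow_eigenvector[OF assms(1,2)] unfolding gen_eigenspace_def by auto

lemma eigenvector_gen_eigenspace: "endo T \<Longrightarrow> T v = a *s v \<Longrightarrow> v \<in> gen_eigenspace T a"
  by (rule gen_eigenspace_step) (simp add: shift_def gen_eigenspace_zero)

lemma shift_inj_gen_eigenspace:
  assumes "endo T" "v \<in> gen_eigenspace T b" "shift T a v = 0" "a \<noteq> b"
  shows "v = 0"
  using gen_eigenspace_eigenvector[OF assms(1) _ assms(2), of a] assms(3,4)
  by (auto simp: shift_def)

text \<open>On the generalized eigenspace for \<open>b\<close>, \<open>shift T a\<close> is
  nilpotent plus the nonzero scalar \<open>b - a\<close>, hence invertible. The invariant subspace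
  \<open>W\<close> is carried along so that the decomposition can be iterated inside the weight
  spaces of other operators.\<close>

lemma shift_surj_gen_eigenspace:
  assumes T: "endo T" and "v \<in> gen_eigenspace T b" "a \<noteq> b"
    and W: "subspace W" "\<And>w. w \<in> W \<Longrightarrow> T w \<in> W" "v \<in> W"
  shows "\<exists>u\<in>gen_eigenspace T b \<inter> W. shift T a u = v"
proof -
  have "v \<in> W \<longrightarrow> v \<in> gen_eigenspace T b \<longrightarrow> (\<exists>u\<in>gen_eigenspace T b \<inter> W. shift T a u = v)"
    using assms(2)
  proof (induction rule: gen_eigenspace_induct)
    case zero
    then show ?case
      using subspace_0[OF W(1)] gen_eigenspace_zero[OF T] endo_zero[OF endo_shift[OF T]] by blast
  next
    case (step v)
    show ?case
    proof (intro impI)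
      assume v: "v \<in> W" "v \<in> gen_eigenspace T b"
      have "shift T b v \<in> W"
        unfolding shift_def by (intro subspace_diff subspace_scale W v)
      then obtain u where u: "u \<in> gen_eigenspace T b \<inter> W" "shift T a u = shift T b v"
        using step gen_eigenspace_shift[OF T v(2)] by blast
      have "shift T a v - shift T b v = (b - a) *s v"
        by (simp add: shift_def scale_left_diff_distrib)
      then have "shift T a ((1 / (b - a)) *s (v - u)) = v"
        using u(2) assms(3) endo_scale[OF endo_shift[OF T]] endo_diff[OF endo_shift[OF T]] by simp
      moreover have "(1 / (b - a)) *s (v - u) \<in> gen_eigenspace T b \<inter> W"
        using u v by (auto intro!: subspace_diff subspace_scale W(1) subspace_gen_eigenspace T)
      ultimately show "\<exists>u\<in>gen_eigenspace T b \<inter> W. shift T a u = v" by blast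
    qed
  qed
  with assms show ?thesis by blast
qed

lemma gen_eigenspace_scale_op:
  assumes "endo T" "v \<in> gen_eigenspace T a"
  shows "v \<in> gen_eigenspace (\<lambda>x. c *s T x) (c * a)"
proof -
  have cT: "endo (\<lambda>x. c *s T x)"
    by (rule endoI) (simp_all add: endo_add[OF assms(1)] endo_scale[OF assms(1)] scale_right_distrib
        mult.commute)
  show ?thesis using assms(2)
  proof (induction rule: gen_eigenspace_induct)
    case (step v)
    have "shift (\<lambda>x. c *s T x) (c * a) v = c *s shift T a v"
      by (simp add: shift_def scale_right_diff_distrib)
    then show ?case
      using subspace_scale[OF subspace_gen_eigenspace[OF cT] step(2)] gen_eigenspace_step by metis
  qed (rule gen_eigenspace_zero[OF cT])
qed

text \<open>Rests on (S + T) - (a + b) = (S - a) + (T - b), with an induction along the chain of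
  \<open>S\<close> and, inside it, one along the chain of \<open>T\<close>. This extends a
  simultaneous generalized eigenvector from a basis of \<open>H\<close> to all of
  \<open>H\<close>.\<close>

lemma gen_eigenspace_add_op:
  assumes S: "endo S" and T: "endo T" and comm: "\<And>x. S (T x) = T (S x)"
    and "v \<in> gen_eigenspace S a" "v \<in> gen_eigenspace T b"
  shows "v \<in> gen_eigenspace (\<lambda>x. S x + T x) (a + b)"
proof -
  let ?U = "\<lambda>x. S x + T x" and ?G = "gen_eigenspace (\<lambda>x. S x + T x) (a + b)"
  have U: "endo ?U"
    by (rule endoI) (simp_all add: endo_add endo_scale S T scale_right_distrib algebra_simps)
  have "v \<in> gen_eigenspace T b \<longrightarrow> v \<in> ?G" using assms(4)
  proof (induction rule: gen_eigenspace_induct)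
    case (step v)
    show ?case
    proof
      assume v: "v \<in> gen_eigenspace T b"
      then have "shift S a v \<in> ?G"
        using step gen_eigenspace_invariant[OF T endo_shift[OF S]] shift_commute[OF T] comm
        by metis
      with v show "v \<in> ?G"
      proof (induction rule: gen_eigenspace_induct)
        case (step v)
        have "shift S a (shift T b v) = shift T b (shift S a v)"
          by (rule shift_commute[OF endo_shift[OF T]]) (simp add: shift_commute[OF S] comm)
        moreover have "shift T b (shift S a v) \<in> ?G"
          by (rule gen_eigenspace_invariant[OF U endo_shift[OF T] _ step.prems])
            (simp add: shift_def endo_add S T endo_diff endo_scale comm scale_right_distrib
              algebra_simps)
        ultimately have "shift T b v \<in> ?G" using step by simp
        moreover have "shift ?U (a + b) v = shift S a v + shift T b v"
          by (simp add: shift_def scale_left_distrib algebra_simps)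
        ultimately have "shift ?U (a + b) v \<in> ?G"
          using subspace_add[OF subspace_gen_eigenspace[OF U]] step.prems by metis
        then show ?case by (rule gen_eigenspace_step)
      qed (rule gen_eigenspace_zero[OF U])
    qed
  qed (simp add: gen_eigenspace_zero[OF U])
  with assms show ?thesis by blast
qed

text \<open>The derivation rule gives (D - a - b)[x, y] = [(D - a) x, y] + [x, (D - b) y], and two
  nested inductions finish. The map \<open>br\<close> will be the Lie bracket and \<open>D\<close>
  an operator \<open>bracket h\<close>.\<close>

lemma gen_eigenspace_product:
  assumes D: "endo D" "\<And>x y. D (br x y) = br (D x) y + br x (D y)"
    and br: "\<And>x. endo (br x)" "\<And>y. endo (\<lambda>x. br x y)"
    and "x \<in> gen_eigenspace D a" "y \<in> gen_eigenspace D b"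
  shows "br x y \<in> gen_eigenspace D (a + b)"
  using assms(5,6)
proof (induction arbitrary: y rule: gen_eigenspace_induct)
  case zero
  then show ?case using endo_zero[OF br(2)] gen_eigenspace_zero[OF D(1)] by simp
next
  case (step x)
  from step.prems show ?case
  proof (induction rule: gen_eigenspace_induct)
    case zero
    then show ?case using endo_zero[OF br(1)] gen_eigenspace_zero[OF D(1)] by simp
  next
    case (step y)
    have "shift D (a + b) (br x y) = br (shift D a x) y + br x (shift D b y)"
      by (simp add: shift_def D(2) scale_left_distrib endo_diff[OF br(1)] endo_scale[OF br(1)]
          endo_diff[OF br(2)] endo_scale[OF br(2)])
    moreover have "br (shift D a x) y \<in> gen_eigenspace D (a + b)"
      using \<open>\<And>y. y \<in> gen_eigenspace D b \<Longrightarrow> br (shift D a x) y \<in> gen_eigenspace D (a + b)\<close> step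
      by blast
    ultimately show ?case
      using subspace_add[OF subspace_gen_eigenspace[OF D(1)]] step.IH gen_eigenspace_step by metis
  qed
qed

section \<open>Polynomials in an operator and the generalized eigenspace decomposition\<close>

definition apply_poly :: "('v \<Rightarrow> 'v) \<Rightarrow> complex poly \<Rightarrow> 'v \<Rightarrow> 'v"
  where "apply_poly T p v = fold_coeffs (\<lambda>a w. a *s v + T w) p 0"

lemma apply_poly_0: "apply_poly T 0 v = 0"
  by (simp add: apply_poly_def)

lemma apply_poly_pCons:
  assumes "endo T"
  shows "apply_poly T (pCons a p) v = a *s v + T (apply_poly T p v)"
  using endo_zero[OF assms] by (cases "a = 0 \<and> p = 0") (auto simp: apply_poly_def)

lemma apply_poly_add:
  assumes "endo T"
  shows "apply_poly T (p + q) v = apply_poly T p v + apply_poly T q v"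
  by (induction p q rule: poly_induct2)
    (simp_all add: apply_poly_pCons apply_poly_0 assms endo_add scale_left_distrib algebra_simps)

lemma apply_poly_smult:
  assumes "endo T"
  shows "apply_poly T (Polynomial.smult c p) v = c *s apply_poly T p v"
  by (induction p)
    (simp_all add: apply_poly_pCons apply_poly_0 assms endo_scale scale_right_distrib)

lemma apply_poly_commute:
  assumes "endo T" "endo U" "\<And>x. U (T x) = T (U x)"
  shows "apply_poly T p (U v) = U (apply_poly T p v)"
  using assms
  by (induction p) (simp_all add: apply_poly_pCons apply_poly_0 endo_add endo_scale endo_zero)

lemma apply_poly_linear_factor:
  assumes "endo T"
  shows "apply_poly T ([:- a, 1:] * q) v = apply_poly T q (shift T a v)"
proof -
  have "[:- a, 1:] * q = Polynomial.smult (- a) q + pCons 0 q"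
    by (simp add: mult_pCons_left)
  then have "apply_poly T ([:- a, 1:] * q) v = shift T a (apply_poly T q v)"
    by (simp only: apply_poly_add apply_poly_smult apply_poly_pCons assms shift_def)
      (simp add: scale_minus_left)
  then show ?thesis
    using apply_poly_commute[OF assms endo_shift[OF assms]] shift_commute[of T T] assms by simp
qed

lemma apply_poly_sum:
  assumes "endo T"
  shows "apply_poly T (\<Sum>i\<in>I. f i) v = (\<Sum>i\<in>I. apply_poly T (f i) v)"
  by (induction I rule: infinite_finite_induct) (simp_all add: apply_poly_0 apply_poly_add assms)

lemma apply_poly_monom:
  assumes "endo T"
  shows "apply_poly T (monom c n) v = c *s (T ^^ n) v"
  by (induction n)
    (simp_all add: monom_0 monom_Suc apply_poly_pCons apply_poly_0 assms endo_zero endo_scale)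

lemma finite_independent: "independent S \<Longrightarrow> finite S"
  using finite_dim independent_span_bound by (metis subset_UNIV)

text \<open>Finite dimension makes the orbit \<open>v\<close>, \<open>T v\<close>, ... dependent.
  Since \<open>dependent\<close> speaks of sets, an orbit with a repetition is treated apart, by a
  difference of two monomials.\<close>

lemma annihilating_poly_exists:
  assumes T: "endo T"
  shows "\<exists>p. p \<noteq> 0 \<and> apply_poly T p v = 0"
proof (cases "inj (\<lambda>n. (T ^^ n) v)")
  case False
  then obtain i j where ij: "i \<noteq> j" "(T ^^ i) v = (T ^^ j) v" unfolding inj_def by blast
  have "coeff (monom 1 i + monom (- 1) j :: complex poly) i \<noteq> 0" using ij(1) by simp
  then have "monom 1 i + monom (- 1) j \<noteq> (0 :: complex poly)" by force
  moreover have "apply_poly T (monom 1 i + monom (- 1) j) v = 0"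
    using ij by (simp add: apply_poly_add apply_poly_monom T scale_minus_left)
  ultimately show ?thesis by blast
next
  case True
  have "dependent (range (\<lambda>n. (T ^^ n) v))"
    using True finite_independent finite_imageD[of "\<lambda>n. (T ^^ n) v" UNIV] infinite_UNIV_nat by blast
  then obtain S u w where S: "finite S" "S \<subseteq> range (\<lambda>n. (T ^^ n) v)"
    "(\<Sum>x\<in>S. u x *s x) = 0" "w \<in> S" "u w \<noteq> 0"
    unfolding dependent_explicit by blast
  then obtain I where I: "finite I" "S = (\<lambda>n. (T ^^ n) v) ` I"
    using finite_subset_image[OF S(1,2)] by blast
  obtain k where k: "k \<in> I" "w = (T ^^ k) v" using I S by blast
  let ?p = "\<Sum>i\<in>I. monom (u ((T ^^ i) v)) i"
  have "coeff ?p k = (\<Sum>i\<in>I. if i = k then u ((T ^^ i) v) else 0)"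
    by (simp add: coeff_sum)
  then have "coeff ?p k \<noteq> 0" using I(1) k S(5) by simp
  then have "?p \<noteq> 0" by force
  moreover have "apply_poly T ?p v = (\<Sum>x\<in>S. u x *s x)"
    unfolding I(2) using inj_on_subset[OF True subset_UNIV]
    by (simp add: apply_poly_sum apply_poly_monom T sum.reindex)
  ultimately show ?thesis using S(3) by metis
qed

text \<open>An annihilating polynomial of \<open>v\<close> splits over the complex numbers, and its
  linear factors are removed one at a time. Once \<open>shift T a v\<close> is decomposed,
  \<open>solve\<close> divides by \<open>shift T a\<close> up to an error in the generalized
  eigenspace for \<open>a\<close>; the error is absorbed because that space contains every vector
  that \<open>shift T a\<close> maps into it.\<close>

lemma span_gen_eigenspaces:
  assumes T: "endo T" and W: "subspace W" "\<And>w. w \<in> W \<Longrightarrow> T w \<in> W" and "v \<in> W"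
  shows "v \<in> span (\<Union>a. gen_eigenspace T a \<inter> W)"
proof -
  let ?G = "\<Union>a. gen_eigenspace T a \<inter> W"
  have solve: "\<exists>w\<in>span ?G. shift T a w - u \<in> gen_eigenspace T a \<inter> W" if "u \<in> span ?G" for u a
    using that
  proof (induction rule: span_induct_alt)
    case base
    then show ?case
      using endo_zero[OF endo_shift[OF T]] gen_eigenspace_zero[OF T] subspace_0[OF W(1)]
      by (intro bexI[of _ 0]) (simp_all add: span_zero)
  next
    case (step c x y)
    then obtain w b where w: "w \<in> span ?G" "shift T a w - y \<in> gen_eigenspace T a \<inter> W"
      and x: "x \<in> gen_eigenspace T b" "x \<in> W" by blast
    \<comment> \<open>On the component for \<open>a\<close> itself the whole vector is error
      (\<open>z = 0\<close>); on every other component \<open>shift T a\<close> is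
      surjective.\<close>
    have "\<exists>z\<in>span ?G. shift T a z - x \<in> gen_eigenspace T a \<inter> W"
    proof (cases "a = b")
      case True
      then show ?thesis
        using x span_zero endo_zero[OF endo_shift[OF T]]
          subspace_neg[OF subspace_gen_eigenspace[OF T]] subspace_neg[OF W(1)]
        by (intro bexI[of _ 0]) auto
    next
      case False
      then obtain z where "z \<in> gen_eigenspace T b \<inter> W" "shift T a z = x"
        using shift_surj_gen_eigenspace[OF T x(1) _ W x(2)] by blast
      then show ?thesis
        using gen_eigenspace_zero[OF T] subspace_0[OF W(1)]
        by (intro bexI[of _ z]) (auto intro: span_base)
    qed
    then obtain z where z: "z \<in> span ?G" "shift T a z - x \<in> gen_eigenspace T a \<inter> W" by blast
    have "shift T a (c *s z + w) - (c *s x + y) = c *s (shift T a z - x) + (shift T a w - y)"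
      by (simp add: endo_add endo_scale endo_shift T scale_right_diff_distrib)
    moreover have "c *s (shift T a z - x) + (shift T a w - y) \<in> gen_eigenspace T a \<inter> W"
      using z w by (auto intro!: subspace_add subspace_scale subspace_gen_eigenspace T W(1))
    ultimately show ?case
      using z w by (metis span_add span_scale)
  qed
  have "p \<noteq> 0 \<Longrightarrow> apply_poly T p v = 0 \<Longrightarrow> v \<in> W \<Longrightarrow> v \<in> span ?G" for p v
  proof (induction "degree p" arbitrary: p v)
    case 0
    then obtain c where "p = [:c:]" by (metis degree_eq_zeroE)
    with 0 have "v = 0" by (simp add: apply_poly_pCons apply_poly_0 T endo_zero)
    then show ?case by (simp add: span_zero)
  next
    case (Suc n)
    then obtain a where "poly p a = 0"
      using fundamental_theorem_of_algebra[of p] constant_degree[of p] by auto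
    then obtain q where q: "p = [:- a, 1:] * q" by (auto simp: poly_eq_0_iff_dvd elim: dvdE)
    have "q \<noteq> 0" using q Suc.prems(1) by auto
    moreover have "n = degree q"
      using Suc.hyps(2) \<open>q \<noteq> 0\<close> unfolding q by (subst (asm) degree_mult_eq) auto
    moreover have "apply_poly T q (shift T a v) = 0"
      using Suc.prems(2) unfolding q by (simp add: apply_poly_linear_factor T del: mult_pCons_left)
    moreover have "shift T a v \<in> W"
      unfolding shift_def by (intro subspace_diff subspace_scale W Suc.prems(3))
    ultimately have "shift T a v \<in> span ?G" using Suc.hyps(1) by blast
    then obtain w where w: "w \<in> span ?G" "shift T a w - shift T a v \<in> gen_eigenspace T a"
      using solve by blast
    have "span ?G \<subseteq> W" by (rule span_minimal) (auto simp: W(1))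
    have "shift T a (w - v) \<in> gen_eigenspace T a"
      using w(2) by (simp add: endo_diff endo_shift T)
    then have "w - v \<in> gen_eigenspace T a" by (rule gen_eigenspace_step)
    moreover have "w - v \<in> W"
      using w(1) \<open>span ?G \<subseteq> W\<close> Suc.prems(3) W(1) by (auto intro: subspace_diff)
    ultimately have "w - v \<in> span ?G" by (auto intro: span_base)
    then show ?case using span_diff[OF w(1)] by fastforce
  qed
  then show ?thesis using annihilating_poly_exists[OF T] assms(4) by blast
qed

section \<open>Simultaneous generalized eigenspaces of commuting operators\<close>

definition weight_space :: "('i \<Rightarrow> 'v \<Rightarrow> 'v) \<Rightarrow> 'i set \<Rightarrow> ('i \<Rightarrow> complex) \<Rightarrow> 'v set"
  where "weight_space T I w = {v. \<forall>i\<in>I. v \<in> gen_eigenspace (T i) (w i)}"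

lemma subspace_weight_space:
  assumes "\<And>i. i \<in> I \<Longrightarrow> endo (T i)"
  shows "subspace (weight_space T I w)"
  unfolding weight_space_def
  using subspace_gen_eigenspace[OF assms] by (intro subspaceI) (auto intro: subspace_add subspace_scale subspace_0)

lemma weight_space_invariant:
  assumes "\<And>i. i \<in> I \<Longrightarrow> endo (T i)" "endo U" "\<And>i x. i \<in> I \<Longrightarrow> U (T i x) = T i (U x)"
    and "v \<in> weight_space T I w"
  shows "U v \<in> weight_space T I w"
  using assms unfolding weight_space_def by (blast intro: gen_eigenspace_invariant)

text \<open>Commuting operators preserve each other's generalized eigenspaces, so each weight space
  for \<open>I\<close> is invariant under the next operator and splits under it, by
  \<open>span_gen_eigenspaces\<close> with this weight space as \<open>W\<close>.\<close>

lemma span_weight_spaces: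
  assumes "finite I" "\<And>i. i \<in> I \<Longrightarrow> endo (T i)"
    and "\<And>i j x. i \<in> I \<Longrightarrow> j \<in> I \<Longrightarrow> T i (T j x) = T j (T i x)"
  shows "span (\<Union>w. weight_space T I w) = UNIV"
  using assms
proof (induction I rule: finite_induct)
  case empty
  then show ?case by (simp add: weight_space_def span_UNIV)
next
  case (insert i I)
  have "weight_space T I w \<subseteq> span (\<Union>w. weight_space T (insert i I) w)" for w
  proof
    fix v assume v: "v \<in> weight_space T I w"
    have "v \<in> span (\<Union>a. gen_eigenspace (T i) a \<inter> weight_space T I w)"
    proof (rule span_gen_eigenspaces)
      show "T i u \<in> weight_space T I w" if "u \<in> weight_space T I w" for u
        using weight_space_invariant[where U = "T i", OF _ _ _ that] insert.prems by blast
    qed (auto intro: subspace_weight_space insert.prems v)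
    moreover have "gen_eigenspace (T i) a \<inter> weight_space T I w
        \<subseteq> weight_space T (insert i I) (w(i := a))" for a
      using insert.hyps(2) unfolding weight_space_def by auto
    then have "(\<Union>a. gen_eigenspace (T i) a \<inter> weight_space T I w)
        \<subseteq> (\<Union>w. weight_space T (insert i I) w)"
      by blast
    ultimately show "v \<in> span (\<Union>w. weight_space T (insert i I) w)"
      using span_mono by blast
  qed
  then have "span (\<Union>w. weight_space T I w) \<subseteq> span (\<Union>w. weight_space T (insert i I) w)"
    by (intro span_minimal) auto
  then show ?case using insert by auto
qed

text \<open>A product of operators \<open>shift (T i) c\<close> with \<open>c \<noteq> \<mu> i\<close> annihilates any given sum of
  vectors from the other weight spaces, but is injective on the weight space of \<open>\<mu>\<close>.\<close>

lemma weight_spaces_independent: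
  assumes T: "\<And>i. i \<in> I \<Longrightarrow> endo (T i)"
    and comm: "\<And>i j x. i \<in> I \<Longrightarrow> j \<in> I \<Longrightarrow> T i (T j x) = T j (T i x)"
    and u: "u \<in> weight_space T I \<mu>"
    and span: "u \<in> span (\<Union>\<nu>\<in>{\<nu>. \<exists>i\<in>I. \<nu> i \<noteq> \<mu> i}. weight_space T I \<nu>)"
  shows "u = 0"
proof -
  define prod where "prod L v = foldr (\<lambda>(i, c). shift (T i) c) L v" for L v
  define good where "good L \<longleftrightarrow> (\<forall>(i, c)\<in>set L. i \<in> I \<and> c \<noteq> \<mu> i)" for L
  have endo_prod: "endo (prod L)" if "good L" for L
    using that unfolding prod_def good_def
    by (induction L) (auto simp: endo_id[unfolded id_def] comp_def intro: endo_comp endo_shift T)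
  have invariant: "prod L v \<in> weight_space T I w" if "good L" "v \<in> weight_space T I w" for L v w
    using that
  proof (induction L)
    case (Cons p L)
    obtain i c where p: "p = (i, c)" by fastforce
    have i: "i \<in> I" using Cons.prems p by (simp add: good_def)
    have "prod (p # L) v = shift (T i) c (prod L v)" by (simp add: prod_def p)
    moreover have "shift (T i) c (prod L v) \<in> weight_space T I w"
      by (rule weight_space_invariant[OF T endo_shift[OF T[OF i]]])
        (use Cons i in \<open>auto simp: good_def shift_commute T comm\<close>)
    ultimately show ?case by simp
  qed (simp add: prod_def)
  have "\<exists>L. good L \<and> prod L u = 0" using span
  proof (induction rule: span_induct_alt)
    case base
    then show ?case by (intro exI[of _ "[]"]) (simp add: prod_def good_def)
  next
    case (step c x y)
    then obtain L \<nu> i where L: "good L" "prod L y = 0" and x: "x \<in> weight_space T I \<nu>"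
      and i: "i \<in> I" "\<nu> i \<noteq> \<mu> i" by blast
    obtain n where n: "(shift (T i) (\<nu> i) ^^ n) (prod L x) = 0"
      using invariant[OF L(1) x] i(1) by (auto simp: weight_space_def gen_eigenspace_def)
    let ?L = "replicate n (i, \<nu> i) @ L"
    have good: "good ?L" using L(1) i by (auto simp: good_def)
    have shift: "prod ?L z = (shift (T i) (\<nu> i) ^^ n) (prod L z)" for z
      by (simp add: prod_def foldr_replicate)
    have "prod ?L (c *s x + y) = 0"
      using n L(2) endo_zero[OF endo_funpow[OF endo_shift[OF T[OF i(1)]]]]
      by (simp add: shift endo_add endo_scale endo_prod[OF L(1)] endo_funpow endo_shift T i(1))
    then show ?case using good by blast
  qed
  then obtain L where L: "good L" "prod L u = 0" by blast
  then show "u = 0"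
  proof (induction L)
    case (Cons p L)
    obtain i c where p: "p = (i, c)" by fastforce
    have ic: "i \<in> I" "c \<noteq> \<mu> i" "good L" using Cons.prems p by (auto simp: good_def)
    have "shift (T i) c (prod L u) = 0" using Cons.prems by (simp add: prod_def p)
    then have "prod L u = 0"
      using shift_inj_gen_eigenspace[OF T[OF ic(1)] _ _ ic(2)] invariant[OF ic(3) u] ic(1)
      by (simp add: weight_space_def)
    then show ?case using Cons.IH ic by blast
  qed (simp add: prod_def)
qed

lemma gen_eigenspaces_independent:
  assumes "endo T" "u \<in> gen_eigenspace T a" "u \<in> span (\<Union>b\<in>-{a}. gen_eigenspace T b)"
  shows "u = 0"
proof (rule weight_spaces_independent[of "{()}" "\<lambda>_. T" u "\<lambda>_. a"])
  have "gen_eigenspace T b \<subseteq> (\<Union>\<nu>\<in>{\<nu>. \<exists>i\<in>{()}. \<nu> i \<noteq> a}. weight_space (\<lambda>_. T) {()} \<nu>)"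
    if "b \<noteq> a" for b
    using that unfolding weight_space_def by (intro subsetI UN_I[of "\<lambda>_. b"]) auto
  then have "(\<Union>b\<in>-{a}. gen_eigenspace T b)
      \<subseteq> (\<Union>\<nu>\<in>{\<nu>. \<exists>i\<in>{()}. \<nu> i \<noteq> a}. weight_space (\<lambda>_. T) {()} \<nu>)"
    by blast
  then show "u \<in> span (\<Union>\<nu>\<in>{\<nu>. \<exists>i\<in>{()}. \<nu> i \<noteq> a}. weight_space (\<lambda>_. T) {()} \<nu>)"
    using assms(3) span_mono by blast
qed (use assms in \<open>auto simp: weight_space_def\<close>)

section \<open>Traces and triangular bases\<close>

lemma sum_representation:
  assumes "independent B" "span B = UNIV"
  shows "(\<Sum>b\<in>B. representation B v b *s b) = v"
proof -
  have "(\<Sum>b\<in>B. representation B v b *s b) = (\<Sum>b | representation B v b \<noteq> 0. representation B v b *s b)"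
    by (rule sum.mono_neutral_right)
      (auto simp: finite_independent assms representation_ne_zero)
  then show ?thesis using sum_nonzero_representation_eq assms by simp
qed

definition basis_trace :: "'v set \<Rightarrow> ('v \<Rightarrow> 'v) \<Rightarrow> complex"
  where "basis_trace B f = (\<Sum>b\<in>B. representation B (f b) b)"

lemma representation_endo:
  assumes "independent B" "span B = UNIV" "independent C" "span C = UNIV" "endo f"
  shows "representation B (f v) b = (\<Sum>c\<in>C. representation C v c * representation B (f c) b)"
proof -
  have "f v = f (\<Sum>c\<in>C. representation C v c *s c)"
    by (simp only: sum_representation[OF assms(3,4)])
  also have "\<dots> = (\<Sum>c\<in>C. representation C v c *s f c)"
    by (simp only: endo_sum[OF assms(5)] endo_scale[OF assms(5)])
  finally have "f v = (\<Sum>c\<in>C. representation C v c *s f c)" .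
  then show ?thesis
    by (simp add: representation_sum representation_scale assms)
qed

text \<open>Both traces are the same double sum of products of matrix entries. Allowing two bases
  makes independence of the basis the special case where one operator is the identity.\<close>

lemma basis_trace_commute:
  assumes "independent B" "span B = UNIV" "independent C" "span C = UNIV" "endo f" "endo g"
  shows "basis_trace B (\<lambda>x. f (g x)) = basis_trace C (\<lambda>x. g (f x))"
proof -
  have "basis_trace B (\<lambda>x. f (g x))
      = (\<Sum>b\<in>B. \<Sum>c\<in>C. representation C (g b) c * representation B (f c) b)"
    unfolding basis_trace_def by (intro sum.cong refl representation_endo assms)
  also have "\<dots> = (\<Sum>c\<in>C. \<Sum>b\<in>B. representation B (f c) b * representation C (g b) c)"
    by (subst sum.swap) (simp add: mult.commute)
  also have "\<dots> = basis_trace C (\<lambda>x. g (f x))"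
    unfolding basis_trace_def by (intro sum.cong refl representation_endo[symmetric] assms)
  finally show ?thesis .
qed

lemma basis_trace_change:
  assumes "independent B" "span B = UNIV" "independent C" "span C = UNIV" "endo f"
  shows "basis_trace B f = basis_trace C f"
  using basis_trace_commute[OF assms endo_id] by simp

lemma basis_trace_add:
  assumes "independent B" "span B = UNIV"
  shows "basis_trace B (\<lambda>x. f x + g x) = basis_trace B f + basis_trace B g"
  unfolding basis_trace_def by (simp add: representation_add assms sum.distrib)

lemma basis_trace_scale:
  assumes "independent B" "span B = UNIV"
  shows "basis_trace B (\<lambda>x. c *s f x) = c * basis_trace B f"
  unfolding basis_trace_def by (simp add: representation_scale assms sum_distrib_left)

lemma basis_trace_diff:
  assumes "independent B" "span B = UNIV"
  shows "basis_trace B (\<lambda>x. f x - g x) = basis_trace B f - basis_trace B g"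
  unfolding basis_trace_def by (simp add: representation_diff assms sum_subtractf)

text \<open>A basis built along a flag of invariant subspaces, with diagonal entries
  \<open>ev\<close>, whose members are moreover generalized eigenvectors. The flag gives the
  diagonal entries of \<open>T\<close> and of its square; the second property makes the basis
  compatible with projections onto sums of generalized eigenspaces.\<close>

inductive triangular :: "('v \<Rightarrow> 'v) \<Rightarrow> ('v \<Rightarrow> complex) \<Rightarrow> 'v set \<Rightarrow> bool"
  for T ev where
    empty: "triangular T ev {}"
  | insert: "triangular T ev B \<Longrightarrow> b \<notin> span B \<Longrightarrow> b \<in> gen_eigenspace T (ev b) \<Longrightarrow>
      shift T (ev b) b \<in> span B \<Longrightarrow> triangular T ev (insert b B)"

lemma triangular_cong:
  assumes "triangular T ev B" "\<And>b. b \<in> B \<Longrightarrow> ev b = ev' b"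
  shows "triangular T ev' B"
  using assms
proof (induction rule: triangular.induct)
  case (insert B b)
  then show ?case by (intro triangular.insert) auto
qed (rule triangular.empty)

lemma triangular_independent: "triangular T ev B \<Longrightarrow> independent B"
  by (induction rule: triangular.induct) (simp_all add: independent_empty independent_insertI)

lemma triangular_span_invariant:
  assumes T: "endo T" and "triangular T ev B" "v \<in> span B"
  shows "T v \<in> span B"
  using assms(2,3)
proof (induction arbitrary: v rule: triangular.induct)
  case empty
  then show ?case using endo_zero[OF T] by simp
next
  case (insert B b)
  obtain k where k: "v - k *s b \<in> span B"
    using insert.prems span_breakdown_eq by blast
  have "T v = T (v - k *s b) + k *s (shift T (ev b) b + ev b *s b)"
    by (simp add: endo_diff[OF T] endo_scale[OF T] shift_def)
  moreover have "span B \<subseteq> span (insert b B)" by (rule span_mono) blast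
  then have "T (v - k *s b) \<in> span (insert b B)" "shift T (ev b) b \<in> span (insert b B)"
    using insert.IH[OF k] insert.hyps(4) by blast+
  moreover have "b \<in> span (insert b B)" by (simp add: span_base)
  ultimately show ?case by (simp add: span_add span_scale)
qed

text \<open>A triangular family of maximal size spans: otherwise some generalized eigenvector lies
  outside its span and leads to one more basis vector.\<close>

lemma triangular_basis_exists:
  assumes T: "endo T"
  shows "\<exists>B ev. triangular T ev B \<and> span B = UNIV"
proof -
  define P where "P n \<longleftrightarrow> (\<exists>B ev. triangular T ev B \<and> card B = n)" for n
  obtain C where C: "finite C" "span C = UNIV" using finite_dim by blast
  have "P 0" unfolding P_def using triangular.empty by fastforce
  moreover have "n \<le> card C" if "P n" for n
    using that independent_span_bound[OF C(1) triangular_independent] C(2) unfolding P_def by auto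
  ultimately obtain n where n: "P n" "\<And>k. P k \<Longrightarrow> k \<le> n"
    using Nat.ex_has_greatest_nat[of P 0 "card C"] by blast
  then obtain B ev where B: "triangular T ev B" "card B = n" unfolding P_def by blast
  have fin: "finite B" using finite_independent triangular_independent[OF B(1)] by blast
  have "span B = UNIV"
  proof (rule ccontr)
    assume "span B \<noteq> UNIV"
    moreover have "span (\<Union>a. gen_eigenspace T a) = UNIV"
      using span_gen_eigenspaces[OF T subspace_UNIV] by auto
    ultimately have "\<not> (\<Union>a. gen_eigenspace T a) \<subseteq> span B"
      using span_minimal[of "\<Union>a. gen_eigenspace T a" "span B"] by auto
    then obtain a v where "v \<in> gen_eigenspace T a" "v \<notin> span B" by blast
    \<comment> \<open>Take the first vector of the chain of \<open>v\<close> whose successor lies in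
      \<open>span B\<close>; the chain ends in 0, so there is one.\<close>
    then have "\<exists>v. v \<in> gen_eigenspace T a \<and> v \<notin> span B \<and> shift T a v \<in> span B"
      by (induction rule: gen_eigenspace_induct) (auto simp: span_zero)
    then obtain b where b: "b \<in> gen_eigenspace T a" "b \<notin> span B" "shift T a b \<in> span B" by blast
    then have "b \<notin> B" using span_base by blast
    then have "triangular T (ev(b := a)) B"
      by (intro triangular_cong[OF B(1)]) auto
    then have "triangular T (ev(b := a)) (insert b B)"
      using b by (intro triangular.insert) auto
    then have "P (Suc n)" using \<open>b \<notin> B\<close> fin B(2) unfolding P_def by (metis card_insert_disjoint)
    then show False using n(2) by fastforce
  qed
  then show ?thesis using B by blast
qed

text \<open>The diagonal of the square is meant for \<open>killing_form t t\<close>, the trace of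
  the square of \<open>bracket t\<close>.\<close>

lemma triangular_diagonal:
  assumes T: "endo T" and "triangular T ev B" "b \<in> B"
  shows "b \<in> gen_eigenspace T (ev b)" "representation B (T b) b = ev b"
    "representation B (T (T b)) b = (ev b)\<^sup>2"
proof -
  have "b \<in> gen_eigenspace T (ev b) \<and> representation B (T b) b = ev b \<and>
    representation B (T (T b)) b = (ev b)\<^sup>2"
    using assms(2,3)
  proof (induction rule: triangular.induct)
    case (insert B c)
    have ind: "independent (insert c B)"
      using triangular_independent triangular.insert insert.hyps by blast
    have inv: "T v \<in> span B" if "v \<in> span B" for v
      using triangular_span_invariant[OF T insert.hyps(1) that] .
    have sub: "v \<in> span (insert c B)" if "v \<in> span B" for v
      using that span_mono[of B "insert c B"] by blast
    have ext: "representation (insert c B) v = representation B v" if "v \<in> span B" for v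
      using representation_extend[OF ind that] by blast
    show ?case
    proof (cases "b = c")
      case True
      let ?u = "shift T (ev c) c"
      have c: "c \<notin> B" using insert.hyps(2) span_base by blast
      have zero: "representation (insert c B) v c = 0" if "v \<in> span B" for v
        using ext[OF that] c representation_ne_zero by metis
      have u: "?u \<in> span B" by fact
      have cs: "k *s c \<in> span (insert c B)" for k by (intro span_scale span_base) simp
      have diag: "representation (insert c B) (v + k *s c) c = k" if "v \<in> span B" for k v
        using zero[OF that] representation_add[OF ind sub[OF that] cs[of k]]
          representation_scale[OF ind span_base, of c k] representation_basis[OF ind, of c]
        by (simp add: add.commute[of v])
      have Tc: "T c = ?u + ev c *s c" by (simp add: shift_def)
      have "T (T c) = T ?u + ev c *s T c"
        by (subst Tc) (simp add: endo_add[OF T] endo_scale[OF T])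
      also have "\<dots> = (T ?u + ev c *s ?u) + (ev c)\<^sup>2 *s c"
        by (simp add: Tc scale_right_distrib power2_eq_square add.assoc)
      finally have TTc: "T (T c) = (T ?u + ev c *s ?u) + (ev c)\<^sup>2 *s c" .
      have "T ?u + ev c *s ?u \<in> span B"
        using u inv by (intro span_add span_scale) auto
      then have "representation (insert c B) (T (T c)) c = (ev c)\<^sup>2"
        unfolding TTc by (rule diag)
      moreover have "representation (insert c B) (T c) c = ev c"
        by (subst Tc) (rule diag[OF u])
      ultimately show ?thesis using insert.hyps(3) True by blast
    next
      case False
      then have "b \<in> B" using insert.prems by simp
      then have "T b \<in> span B" "T (T b) \<in> span B" using inv span_base by blast+
      then show ?thesis using insert.IH \<open>b \<in> B\<close> ext by simp
    qed
  qed simp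
  then show "b \<in> gen_eigenspace T (ev b)" "representation B (T b) b = ev b"
    "representation B (T (T b)) b = (ev b)\<^sup>2" by auto
qed

text \<open>The part of \<open>v\<close> on basis vectors with other eigenvalues is \<open>v\<close>
  minus a vector of the generalized eigenspace for \<open>a\<close>. It lies in that space and in
  the span of the others at once, so it is 0.\<close>

lemma triangular_representation:
  assumes T: "endo T" and B: "triangular T ev B" "span B = UNIV"
    and "v \<in> gen_eigenspace T a" "b \<in> B" "ev b \<noteq> a"
  shows "representation B v b = 0"
proof -
  let ?r = "representation B v" and ?C = "{b\<in>B. ev b = a}" and ?D = "{b\<in>B. ev b \<noteq> a}"
  have ind: "independent B" and fin: "finite B"
    using triangular_independent[OF B(1)] finite_independent by auto
  let ?u = "\<Sum>b\<in>?D. ?r b *s b"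
  have "B = ?C \<union> ?D" by blast
  then have "(\<Sum>b\<in>B. ?r b *s b) = (\<Sum>b\<in>?C. ?r b *s b) + ?u"
    using fin by (subst sum.union_disjoint[symmetric]) auto
  then have v: "?u = v - (\<Sum>b\<in>?C. ?r b *s b)"
    by (simp add: sum_representation[OF ind B(2)] eq_diff_eq add.commute)
  have eig: "b \<in> gen_eigenspace T (ev b)" if "b \<in> B" for b
    using triangular_diagonal(1)[OF T B(1) that] .
  have "(\<Sum>b\<in>?C. ?r b *s b) \<in> gen_eigenspace T a"
    by (intro subspace_sum subspace_scale subspace_gen_eigenspace T) (auto dest: eig)
  then have "?u \<in> gen_eigenspace T a"
    unfolding v by (intro subspace_diff subspace_gen_eigenspace T assms(4))
  moreover have "?u \<in> span (\<Union>b\<in>-{a}. gen_eigenspace T b)"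
    by (intro span_sum span_scale span_base) (auto dest: eig)
  ultimately have "?u = 0" by (rule gen_eigenspaces_independent[OF T])
  moreover have "finite ?D" "b \<in> ?D" using fin assms(5,6) by auto
  ultimately show ?thesis using independentD[OF ind, of ?D ?r b] by blast
qed

end

section \<open>The Killing form and eigenvalues of brackets\<close>

sublocale complex_lie_algebra \<subseteq> complex_fin_dim
  by unfold_locales (rule finite_dim)

context complex_lie_algebra
begin

lemma endo_bracket: "endo (bracket x)"
  by (rule endoI) (rule bracket_add_right bracket_scale_right)+

lemma endo_bracket_left: "endo (\<lambda>x. bracket x y)"
  by (rule endoI) (rule bracket_add_left bracket_scale_left)+

lemmas bracket_zero [simp] = endo_zero[OF endo_bracket] endo_zero[OF endo_bracket_left]

lemma bracket_antisym: "bracket y x = - bracket x y"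
proof -
  have "bracket (x + y) (x + y) = bracket x y + bracket y x"
    unfolding bracket_add_left bracket_add_right by (simp add: bracket_self)
  then show ?thesis by (simp add: bracket_self minus_unique[symmetric])
qed

lemma bracket_derivation:
  "bracket x (bracket y z) = bracket (bracket x y) z + bracket y (bracket x z)"
  using jacobi[of x y z] bracket_antisym[of z x] bracket_antisym[of z "bracket x y"]
    module_hom.neg[OF endo_module_hom[OF endo_bracket], of y "bracket x z"]
  by (simp add: algebra_simps eq_neg_iff_add_eq_0)

lemma bracket_bracket_left:
  "bracket (bracket x y) z = bracket x (bracket y z) - bracket y (bracket x z)"
  by (simp add: bracket_derivation[of x])

lemma bracket_gen_eigenspace:
  assumes "x \<in> gen_eigenspace (bracket h) a" "y \<in> gen_eigenspace (bracket h) b"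
  shows "bracket x y \<in> gen_eigenspace (bracket h) (a + b)"
  by (rule gen_eigenspace_product[OF endo_bracket bracket_derivation endo_bracket
      endo_bracket_left assms])

lemma trace_eq_basis_trace:
  assumes "independent B" "span B = UNIV" "endo f"
  shows "trace f = basis_trace B f"
  using basis_trace_change[OF _ _ assms] independent_extend_basis[OF independent_empty]
    span_extend_basis[OF independent_empty]
  by (simp add: trace_def basis_trace_def)

lemma trace_basis_trace: "trace f = basis_trace (extend_basis {}) f"
  by (simp add: trace_def basis_trace_def)

lemmas extend_basis_empty =
  independent_extend_basis[OF independent_empty] span_extend_basis[OF independent_empty]

lemma killing_form_add_right: "killing_form x (y + z) = killing_form x y + killing_form x z"
  by (simp add: killing_form_def trace_basis_trace bracket_add_left bracket_add_right
      basis_trace_add[OF extend_basis_empty])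

lemma killing_form_scale_right: "killing_form x (scale c y) = c * killing_form x y"
  by (simp add: killing_form_def trace_basis_trace bracket_scale_left bracket_scale_right
      basis_trace_scale[OF extend_basis_empty])

lemma killing_form_sym: "killing_form x y = killing_form y x"
  unfolding killing_form_def trace_basis_trace
  by (rule basis_trace_commute[OF extend_basis_empty extend_basis_empty endo_bracket endo_bracket])

lemma killing_form_add_left: "killing_form (x + y) z = killing_form x z + killing_form y z"
  using killing_form_add_right killing_form_sym by metis

lemma killing_form_scale_left: "killing_form (scale c x) y = c * killing_form x y"
  using killing_form_scale_right killing_form_sym by metis

lemma killing_form_zero [simp]: "killing_form 0 y = 0" "killing_form x 0 = 0"
  using killing_form_scale_left[of 0 0 y] killing_form_scale_right[of x 0 0] by simp_all

lemma killing_form_diff_left: "killing_form (x - y) z = killing_form x z - killing_form y z"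
  using killing_form_add_left[of "x - y" y z] by simp

lemma killing_form_diff_right: "killing_form x (y - z) = killing_form x y - killing_form x z"
  using killing_form_add_right[of x "y - z" z] by simp

text \<open>After \<open>bracket_bracket_left\<close> both sides are differences of traces of triple
  products, which agree by cyclicity.\<close>

lemma killing_form_invariant: "killing_form (bracket x y) z = killing_form x (bracket y z)"
proof -
  let ?tr = "basis_trace (extend_basis {})"
  have "?tr (\<lambda>v. bracket y (bracket x (bracket z v))) = ?tr (\<lambda>v. bracket x (bracket z (bracket y v)))"
    by (rule basis_trace_commute[OF extend_basis_empty extend_basis_empty endo_bracket
          endo_comp[OF endo_bracket endo_bracket]])
  then show ?thesis
    unfolding killing_form_def trace_basis_trace bracket_bracket_left
    by (simp add: endo_diff[OF endo_bracket] basis_trace_diff[OF extend_basis_empty])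
qed

text \<open>By invariance, pairing \<open>x\<close> with \<open>shift (bracket h) b y\<close> gives
  \<open>- (a + b)\<close> times the pairing with \<open>y\<close>. The hypotheses are asymmetric
  because \<open>x\<close> will be a root vector or an element of \<open>H\<close>, both genuine
  eigenvectors, while \<open>y\<close> is only known to be a weight vector.\<close>

lemma killing_form_eigen_orthogonal:
  assumes "bracket h x = scale a x" "y \<in> gen_eigenspace (bracket h) b" "a + b \<noteq> 0"
  shows "killing_form x y = 0"
  using assms(2)
proof (induction rule: gen_eigenspace_induct)
  case (step y)
  have "killing_form x (bracket h y) = - (a * killing_form x y)"
    using killing_form_invariant[of x h y] assms(1) bracket_antisym[of x h]
      killing_form_scale_left[of "- a" x y]
    by (simp add: scale_minus_left)
  then have "(a + b) * killing_form x y = 0"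
    using step.IH by (simp add: shift_def killing_form_diff_right killing_form_scale_right
        algebra_simps eq_neg_iff_add_eq_0)
  then show ?case using assms(3) by simp
qed simp

text \<open>For a set \<open>S\<close> of eigenvalues stable under translation by \<open>\<plusminus>a\<close>, the projection \<open>P\<close> to the sum
  of the generalized eigenspaces of \<open>ad t\<close> for \<open>S\<close> commutes with \<open>ad x\<close> and \<open>ad y\<close>; hence
  \<open>P \<circ> ad t = [P \<circ> ad x, ad y]\<close> has trace zero.\<close>

lemma sum_eigenvalues_eq_0:
  assumes t: "t = bracket x y"
    and x: "x \<in> gen_eigenspace (bracket t) a" and y: "y \<in> gen_eigenspace (bracket t) (- a)"
    and B: "triangular (bracket t) ev B" "span B = UNIV"
    and S: "\<And>c. c + a \<in> S \<longleftrightarrow> c \<in> S"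
  shows "(\<Sum>b | b \<in> B \<and> ev b \<in> S. ev b) = 0"
proof -
  let ?G = "gen_eigenspace (bracket t)"
  have ind: "independent B" and fin: "finite B"
    using triangular_independent[OF B(1)] finite_independent by auto
  note ind_span = ind B(2)
  define P where "P v = (\<Sum>b | b \<in> B \<and> ev b \<in> S. scale (representation B v b) b)" for v
  have endo_P: "endo P"
    by (rule endoI) (simp_all add: P_def representation_add representation_scale ind B(2)
        scale_left_distrib sum.distrib scale_sum_right)
  have P_eigen: "P v = (if c \<in> S then v else 0)" if "v \<in> ?G c" for v c
  proof (cases "c \<in> S")
    case True
    have "P v = (\<Sum>b\<in>B. scale (representation B v b) b)"
      unfolding P_def using True triangular_representation[OF endo_bracket B that] fin
      by (intro sum.mono_neutral_left) auto
    then show ?thesis using True sum_representation[OF ind_span] by simp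
  next
    case False
    then have "representation B v b = 0" if "b \<in> B" "ev b \<in> S" for b
      using triangular_representation[OF endo_bracket B \<open>v \<in> ?G c\<close>] that by blast
    then show ?thesis unfolding P_def using False by (auto intro: sum.neutral)
  qed
  have commute: "P (bracket z v) = bracket z (P v)"
    if z: "z \<in> ?G d" and d: "\<And>c. c + d \<in> S \<longleftrightarrow> c \<in> S" for z d v
  proof -
    have "v \<in> span (\<Union>c. ?G c)"
      using span_gen_eigenspaces[OF endo_bracket subspace_UNIV] by auto
    then show ?thesis
    proof (induction rule: span_induct_alt)
      case base
      then show ?case using endo_zero[OF endo_P] by simp
    next
      case (step k u v)
      then obtain c where u: "u \<in> ?G c" by blast
      have "P (bracket z u) = bracket z (P u)"
        using P_eigen[OF u] P_eigen[OF bracket_gen_eigenspace[OF z u]] d[of c]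
        by (simp add: add.commute)
      then show ?case
        using step.IH
        by (simp add: endo_add[OF endo_P] endo_scale[OF endo_P] endo_add[OF endo_bracket]
            endo_scale[OF endo_bracket])
    qed
  qed
  have S': "c + - a \<in> S \<longleftrightarrow> c \<in> S" for c using S[of "c - a"] by simp
  have "P (bracket t v) = P (bracket x (bracket y v)) - bracket y (P (bracket x v))" for v
    unfolding t bracket_bracket_left endo_diff[OF endo_P]
    by (simp add: commute[OF y S', unfolded t])
  moreover have "basis_trace B (\<lambda>v. bracket y (P (bracket x v)))
      = basis_trace B (\<lambda>v. P (bracket x (bracket y v)))"
    by (rule basis_trace_commute[OF ind_span ind_span endo_bracket
          endo_comp[OF endo_P endo_bracket]])
  ultimately have "basis_trace B (\<lambda>v. P (bracket t v)) = 0"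
    by (simp add: basis_trace_diff[OF ind_span])
  \<comment> \<open>In the adapted basis \<open>P\<close> is a diagonal 0-1 matrix, so the trace of
    \<open>P\<close> after \<open>bracket t\<close> is the sum of the diagonal entries selected by
    \<open>S\<close>.\<close>
  moreover have "representation B (P v) b = (if ev b \<in> S then representation B v b else 0)"
    if "b \<in> B" for v b
  proof -
    have "representation B (P v) b
        = (\<Sum>c | c \<in> B \<and> ev c \<in> S. if c = b then representation B v c else 0)"
      unfolding P_def
      by (simp add: representation_sum representation_scale ind_span representation_basis[OF ind]
          if_distrib eq_commute cong: if_cong)
    then show ?thesis using fin that by simp
  qed
  ultimately have "(\<Sum>b\<in>B. if ev b \<in> S then representation B (bracket t b) b else 0) = 0"
    unfolding basis_trace_def by simp
  moreover have "(\<Sum>b\<in>B. if ev b \<in> S then representation B (bracket t b) b else 0)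
      = (\<Sum>b\<in>B. if ev b \<in> S then ev b else 0)"
    by (rule sum.cong) (simp_all add: triangular_diagonal(2)[OF endo_bracket B(1)])
  ultimately have "(\<Sum>b\<in>B. if ev b \<in> S then ev b else 0) = 0" by simp
  then show ?thesis using fin by (simp add: sum.If_cases Int_def)
qed

lemma eigenvalue_in_triangular_basis:
  assumes "endo T" "triangular T ev B" "span B = UNIV" "v \<in> gen_eigenspace T c" "v \<noteq> 0"
  shows "c \<in> ev ` B"
proof (rule ccontr)
  assume "c \<notin> ev ` B"
  then have "representation B v b = 0" if "b \<in> B" for b
    using triangular_representation[OF assms(1-4) that] that by blast
  then show False
    using sum_representation[OF triangular_independent[OF assms(2)] assms(3), of v] assms(5) by simp
qed

text \<open>If \<open>Re (a * w) = 0\<close>, the half-plane of all \<open>c\<close> with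
  \<open>Re (c * w) > 0\<close> is stable under translation by \<open>a\<close>. The eigenvalues in
  it sum to 0, although each of them times \<open>w\<close> has positive real part; so there are
  none. Taking both \<open>w\<close> and \<open>- w\<close> leaves only the line through
  \<open>a\<close>.\<close>

lemma eigenvalue_real_multiple:
  assumes t: "t = bracket x y"
    and x: "x \<in> gen_eigenspace (bracket t) a" and y: "y \<in> gen_eigenspace (bracket t) (- a)"
    and v: "v \<in> gen_eigenspace (bracket t) c" "v \<noteq> 0"
  shows "\<exists>r::real. c = of_real r * a"
proof -
  obtain B ev where B: "triangular (bracket t) ev B" "span B = UNIV"
    using triangular_basis_exists[OF endo_bracket] by blast
  obtain b where b: "b \<in> B" "ev b = c"
    using eigenvalue_in_triangular_basis[OF endo_bracket B v] by blast
  have fin: "finite B"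
    using triangular_independent[OF B(1)] finite_independent by auto
  have le: "Re (c * w) \<le> 0" if w: "Re (a * w) = 0" for w
  proof (rule ccontr)
    assume "\<not> ?thesis"
    let ?S = "{c. Re (c * w) > 0}"
    let ?A = "{b. b \<in> B \<and> ev b \<in> ?S}"
    have "(\<Sum>b\<in>?A. ev b) = 0"
      by (rule sum_eigenvalues_eq_0[OF t x y B]) (use w in \<open>simp add: distrib_right\<close>)
    then have "Re ((\<Sum>b\<in>?A. ev b) * w) = 0" by simp
    then have "(\<Sum>b\<in>?A. Re (ev b * w)) = 0" by (simp add: sum_distrib_right)
    moreover have "(\<Sum>b\<in>?A. Re (ev b * w)) > 0"
      using fin b \<open>\<not> Re (c * w) \<le> 0\<close> by (intro sum_pos2[of _ b]) auto
    ultimately show False by simp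
  qed
  have orth: "Re (c * w) = 0" if "Re (a * w) = 0" for w
    using le[of w] le[of "- w"] that by simp
  show ?thesis
  proof (cases "a = 0")
    case True
    \<comment> \<open>For \<open>a = 0\<close> every \<open>w\<close> is admissible, and
      \<open>cnj c\<close> gives |c|^2 = 0.\<close>
    then show ?thesis using orth[of "cnj c"] by (simp add: complex_mult_cnj complex_eq_iff)
  next
    case False
    \<comment> \<open>The product of \<open>a\<close> with \<open>\<i> * cnj a\<close> is purely
      imaginary, and the real part of \<open>c\<close> times the same number is
      \<open>- Im (c * cnj a)\<close>.\<close>
    have "Im (c * cnj a) = 0" using orth[of "\<i> * cnj a"] by (simp add: algebra_simps)
    then obtain k where k: "c * cnj a = of_real k" by (metis complex_is_Real_iff Reals_cases)
    have "c = (c * cnj a) / (a * cnj a) * a" using False by simp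
    also have "\<dots> = of_real (k / (cmod a)\<^sup>2) * a"
      using k complex_norm_square[of a] by simp
    finally have "c = of_real (k / (cmod a)\<^sup>2) * a" .
    then show ?thesis by blast
  qed
qed

text \<open>With eigenvalues \<open>r b * a\<close>, the trace of the square is a^2 times a sum of
  real squares, so \<open>a = 0\<close> or all \<open>r b\<close> vanish. The second case also gives
  \<open>a = 0\<close>, because \<open>a\<close> is itself an eigenvalue as soon as \<open>x\<close>
  is nonzero. All eigenvalues are then real multiples of 0.\<close>

lemma isotropic_bracket_nilpotent:
  assumes t: "t = bracket x y"
    and x: "x \<in> gen_eigenspace (bracket t) a" and y: "y \<in> gen_eigenspace (bracket t) (- a)"
    and v: "v \<in> gen_eigenspace (bracket t) c" "v \<noteq> 0"
    and "killing_form t t = 0"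
  shows "c = 0"
proof (cases "x = 0")
  case True
  then have "bracket t v = scale 0 v" by (simp add: t)
  then show ?thesis using gen_eigenspace_eigenvector[OF endo_bracket _ v] by blast
next
  case False
  obtain B ev where B: "triangular (bracket t) ev B" "span B = UNIV"
    using triangular_basis_exists[OF endo_bracket] by blast
  have ind: "independent B" and fin: "finite B"
    using triangular_independent[OF B(1)] finite_independent by auto
  have "\<exists>r::real. ev b = of_real r * a" if "b \<in> B" for b
  proof (rule eigenvalue_real_multiple[OF t x y triangular_diagonal(1)[OF endo_bracket B(1) that]])
    show "b \<noteq> 0" using ind that dependent_zero by blast
  qed
  then obtain r :: "'g \<Rightarrow> real" where r: "\<And>b. b \<in> B \<Longrightarrow> ev b = of_real (r b) * a" by metis
  have "killing_form t t = (\<Sum>b\<in>B. (ev b)\<^sup>2)"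
    unfolding killing_form_def
    using trace_eq_basis_trace[OF ind B(2) endo_comp[OF endo_bracket endo_bracket]]
      triangular_diagonal(3)[OF endo_bracket B(1)]
    by (simp add: basis_trace_def)
  also have "\<dots> = of_real (\<Sum>b\<in>B. (r b)\<^sup>2) * a\<^sup>2"
    by (simp add: r power_mult_distrib sum_distrib_right)
  finally have sum: "of_real (\<Sum>b\<in>B. (r b)\<^sup>2) * a\<^sup>2 = 0" using assms(6) by simp
  have "a = 0"
  proof (rule ccontr)
    assume "a \<noteq> 0"
    then have "(\<Sum>b\<in>B. (r b)\<^sup>2) = 0"
      using sum by (metis mult_eq_0_iff of_real_eq_0_iff power_not_zero)
    then have "\<forall>b\<in>B. r b = 0" using fin by (simp add: sum_nonneg_eq_0_iff)
    then show False
      using eigenvalue_in_triangular_basis[OF endo_bracket B x False] r \<open>a \<noteq> 0\<close> by auto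
  qed
  then show ?thesis using eigenvalue_real_multiple[OF t x y v] by simp
qed

end

section \<open>Weights of a Cartan subalgebra\<close>

locale simple_lie_algebra = complex_lie_algebra scale bracket
  for scale :: "complex \<Rightarrow> 'g :: ab_group_add \<Rightarrow> 'g" and bracket +
  fixes H :: "'g set" and \<alpha> :: "nat \<Rightarrow> 'g \<Rightarrow> complex"
  assumes simple: "simple" and cartan: "cartan_subalgebra H" and simple_roots: "simple_roots H \<alpha>"
begin

lemma subspace_H: "subspace H"
  and H_bracket: "x \<in> H \<Longrightarrow> y \<in> H \<Longrightarrow> bracket x y \<in> H"
  and normalizer: "(\<And>y. y \<in> H \<Longrightarrow> bracket x y \<in> H) \<Longrightarrow> x \<in> H"
  using cartan unfolding cartan_subalgebra_def subalgebra_def by blast+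

lemma
  shows roots_\<alpha>: "i < dim H \<Longrightarrow> \<alpha> i \<in> roots H"
    and inj_\<alpha>: "inj_on \<alpha> {..<dim H}"
    and independent_\<alpha>: "fun_space.independent (\<alpha> ` {..<dim H})"
    and span_\<alpha>: "fun_space.span (\<alpha> ` {..<dim H}) = dual H"
  using simple_roots unfolding simple_roots_def by auto

lemma dual_scale: "\<xi> \<in> dual H \<Longrightarrow> x \<in> H \<Longrightarrow> \<xi> (scale c x) = c * \<xi> x"
  and dual_outside: "\<xi> \<in> dual H \<Longrightarrow> x \<notin> H \<Longrightarrow> \<xi> x = 0"
  unfolding dual_def by auto

lemma roots_dual: "\<beta> \<in> roots H \<Longrightarrow> \<beta> \<in> dual H"
  unfolding roots_def by blast

lemma root_vector:
  assumes "\<beta> \<in> roots H"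
  obtains x where "x \<noteq> 0" "\<And>h. h \<in> H \<Longrightarrow> bracket h x = scale (\<beta> h) x"
  using assms unfolding roots_def by blast

text \<open>The roots span \<open>dual H\<close>, so an element killed by all roots is killed by
  every linear form on \<open>H\<close>, among them the coordinate form \<open>\<xi>\<close> of
  \<open>t\<close> in a basis through \<open>t\<close>.\<close>

lemma roots_separate:
  assumes t: "t \<in> H" and roots: "\<And>\<beta>. \<beta> \<in> roots H \<Longrightarrow> \<beta> t = 0"
  shows "t = 0"
proof (rule ccontr)
  assume "t \<noteq> 0"
  let ?B = "extend_basis {t}"
  have "independent {t}" using \<open>t \<noteq> 0\<close> by simp
  then have B: "independent ?B" "span ?B = UNIV" "t \<in> ?B"
    using independent_extend_basis span_extend_basis extend_basis_superset[of "{t}"] by auto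
  define \<xi> where "\<xi> x = (if x \<in> H then representation ?B x t else 0)" for x
  have "\<xi> \<in> dual H"
    unfolding dual_def \<xi>_def
    by (simp add: representation_add representation_scale B subspace_add[OF subspace_H]
        subspace_scale[OF subspace_H])
  then have "\<xi> \<in> fun_space.span (\<alpha> ` {..<dim H})" using span_\<alpha> by simp
  moreover have "fun_space.span (\<alpha> ` {..<dim H}) \<subseteq> {f. f t = 0}"
    by (rule fun_space.span_minimal)
      (auto simp: roots_\<alpha> roots fun_scale_def intro!: fun_space.subspaceI)
  ultimately have "\<xi> t = 0" by auto
  then show False using t representation_basis[OF B(1,3)] by (simp add: \<xi>_def)
qed

text \<open>A root is the character by which \<open>H\<close> acts on a root vector, so it vanishes
  on brackets; then \<open>roots_separate\<close> applies. Commutativity is what permits a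
  simultaneous decomposition under \<open>H\<close>.\<close>

lemma H_abelian:
  assumes "x \<in> H" "y \<in> H"
  shows "bracket x y = 0"
proof (rule roots_separate[OF H_bracket[OF assms]])
  fix \<beta> assume "\<beta> \<in> roots H"
  then obtain v where v: "v \<noteq> 0" "\<And>h. h \<in> H \<Longrightarrow> bracket h v = scale (\<beta> h) v"
    using root_vector by blast
  have "bracket (bracket x y) v = 0"
    using assms v(2) by (simp add: bracket_bracket_left bracket_scale_right mult.commute)
  then show "\<beta> (bracket x y) = 0" using v H_bracket[OF assms] by simp
qed

lemma ad_H_commute:
  assumes "h \<in> H" "k \<in> H"
  shows "bracket h (bracket k x) = bracket k (bracket h x)"
  using bracket_derivation[of h k x] H_abelian[OF assms] by simp

text \<open>Arbitrary functions serve as weights and only their values on \<open>H\<close> count, so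
  different \<open>w\<close> may denote the same space; hence the pointwise conditions on
  \<open>H\<close> below.\<close>

abbreviation weight :: "('g \<Rightarrow> complex) \<Rightarrow> 'g set"
  where "weight \<equiv> weight_space bracket H"

lemma weight_gen_eigenspace: "x \<in> weight w \<Longrightarrow> h \<in> H \<Longrightarrow> x \<in> gen_eigenspace (bracket h) (w h)"
  by (simp add: weight_space_def)

lemma finite_basis_H: "\<exists>B. finite B \<and> independent B \<and> B \<subseteq> H \<and> span B = H \<and> card B = dim H"
proof -
  obtain B where B: "B \<subseteq> H" "independent B" "H \<subseteq> span B" "card B = dim H"
    using basis_exists by blast
  then have "span B = H" using span_minimal[OF B(1) subspace_H] by blast
  with B finite_independent show ?thesis by blast
qed

text \<open>\<open>span_weight_spaces\<close> handles finitely many operators, here those of a basis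
  of \<open>H\<close>. A simultaneous generalized eigenvector for the basis is one for each linear
  combination, by \<open>gen_eigenspace_scale_op\<close> and
  \<open>gen_eigenspace_add_op\<close>.\<close>

lemma span_weights: "span (\<Union>w. weight w) = UNIV"
proof -
  obtain B where B: "finite B" "B \<subseteq> H" "span B = H" using finite_basis_H by blast
  have "weight_space bracket B w \<subseteq> (\<Union>w. weight w)" for w
  proof
    fix x assume x: "x \<in> weight_space bracket B w"
    have "h \<in> H \<and> (\<exists>a. x \<in> gen_eigenspace (bracket h) a)" if "h \<in> span B" for h
      using that
    proof (induction rule: span_induct_alt)
      case base
      have "bracket 0 x = scale 0 x" by simp
      then show ?case
        using eigenvector_gen_eigenspace[OF endo_bracket] subspace_0[OF subspace_H] by blast
    next
      case (step c b y)
      then obtain a where a: "y \<in> H" "x \<in> gen_eigenspace (bracket y) a" by blast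
      have b: "x \<in> gen_eigenspace (bracket b) (w b)"
        using x step.hyps by (simp add: weight_space_def)
      have scale_b: "x \<in> gen_eigenspace (bracket (scale c b)) (c * w b)"
        using gen_eigenspace_scale_op[OF endo_bracket b, of c]
        by (simp only: bracket_scale_left[symmetric])
      have H: "scale c b \<in> H" using step.hyps B(2) subspace_scale[OF subspace_H] by blast
      have "x \<in> gen_eigenspace (\<lambda>z. bracket (scale c b) z + bracket y z) (c * w b + a)"
        by (rule gen_eigenspace_add_op[OF endo_bracket endo_bracket ad_H_commute[OF H a(1)]
            scale_b a(2)])
      then have "x \<in> gen_eigenspace (bracket (scale c b + y)) (c * w b + a)"
        by (simp only: bracket_add_left[symmetric])
      then show ?case using subspace_add[OF subspace_H H a(1)] by blast
    qed
    then have "\<forall>h\<in>H. \<exists>a. x \<in> gen_eigenspace (bracket h) a" using B(3) by blast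
    then obtain w' where "\<forall>h\<in>H. x \<in> gen_eigenspace (bracket h) (w' h)"
      using bchoice[of H "\<lambda>h a. x \<in> gen_eigenspace (bracket h) a"] by blast
    then have "x \<in> weight w'" by (simp add: weight_space_def)
    then show "x \<in> (\<Union>w. weight w)" by blast
  qed
  then have "span (\<Union>w. weight_space bracket B w) \<subseteq> span (\<Union>w. weight w)"
    by (intro span_mono) blast
  moreover have "span (\<Union>w. weight_space bracket B w) = UNIV"
    using B(2) by (intro span_weight_spaces[OF B(1) endo_bracket] ad_H_commute) auto
  ultimately show ?thesis by blast
qed

lemma weight_bracket:
  assumes "x \<in> weight w" "y \<in> weight u"
  shows "bracket x y \<in> weight (\<lambda>h. w h + u h)"
  using assms unfolding weight_space_def by (auto intro: bracket_gen_eigenspace)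

text \<open>The commuting operators \<open>bracket h\<close> are nilpotent on this space, so from a
  vector outside \<open>H\<close> one can move, one basis element of \<open>H\<close> at a time, to
  a vector outside \<open>H\<close> that all of them send into \<open>H\<close>. Such a vector
  normalizes \<open>H\<close>, and a Cartan subalgebra is its own normalizer.\<close>

lemma weight_zero_in_H:
  assumes "v \<in> weight (\<lambda>_. 0)"
  shows "v \<in> H"
proof (rule ccontr)
  assume "v \<notin> H"
  obtain B where B: "finite B" "B \<subseteq> H" "span B = H" using finite_basis_H by blast
  have "\<exists>u. u \<in> weight (\<lambda>_. 0) \<and> u \<notin> H \<and> (\<forall>h\<in>B. bracket h u \<in> H)"
    using B(1,2)
  proof (induction B rule: finite_induct)
    case empty
    then show ?case using assms \<open>v \<notin> H\<close> by blast
  next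
    case (insert h B)
    then obtain u where u: "u \<in> weight (\<lambda>_. 0)" "u \<notin> H" "\<forall>k\<in>B. bracket k u \<in> H" by auto
    have h: "h \<in> H" "B \<subseteq> H" using insert.prems by auto
    have "u \<in> gen_eigenspace (bracket h) 0" using weight_gen_eigenspace[OF u(1) h(1)] .
    then show ?case using u
    proof (induction rule: gen_eigenspace_induct)
      case zero
      then show ?case using subspace_0[OF subspace_H] by blast
    next
      case (step u)
      have shift: "shift (bracket h) 0 u = bracket h u" by (simp add: shift_def)
      show ?case
      proof (cases "bracket h u \<in> H")
        case True
        then show ?thesis using step.prems by blast
      next
        case False
        have "bracket h u \<in> weight (\<lambda>_. 0)"
          by (rule weight_space_invariant[OF endo_bracket endo_bracket ad_H_commute step.prems(1)])
            (rule h)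
        \<comment> \<open>Commutativity preserves what was achieved for the earlier basis
          elements.\<close>
        moreover have "bracket k (bracket h u) \<in> H" if "k \<in> B" for k
          using ad_H_commute[of k h u] H_bracket[of h "bracket k u"] that h step.prems(3) by auto
        ultimately show ?thesis using step.IH False unfolding shift by blast
      qed
    qed
  qed
  then obtain u where u: "u \<notin> H" "\<And>h. h \<in> B \<Longrightarrow> bracket h u \<in> H" by blast
  have "bracket u h \<in> H" if "h \<in> span B" for h
    using that
  proof (induction rule: span_induct_alt)
    case base
    then show ?case using subspace_0[OF subspace_H] by simp
  next
    case (step c b y)
    have "bracket u b \<in> H"
      using u(2)[OF step.hyps] bracket_antisym[of u b] subspace_neg[OF subspace_H] by simp
    then show ?case using step.IH
      by (simp add: bracket_add_right bracket_scale_right subspace_add[OF subspace_H]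
          subspace_scale[OF subspace_H])
  qed
  then show False using normalizer u(1) B(3) by blast
qed

lemma weight_eq_H: "weight w = H" if "\<And>h. h \<in> H \<Longrightarrow> w h = 0"
proof -
  have "weight w = weight (\<lambda>_. 0)" using that by (simp add: weight_space_def)
  moreover have "x \<in> weight (\<lambda>_. 0)" if "x \<in> H" for x
    unfolding weight_space_def
  proof (intro CollectI ballI)
    fix h assume "h \<in> H"
    then have "bracket h x = scale 0 x" using H_abelian that by simp
    then show "x \<in> gen_eigenspace (bracket h) 0"
      by (rule eigenvector_gen_eigenspace[OF endo_bracket])
  qed
  ultimately show ?thesis using weight_zero_in_H by blast
qed

text \<open>The bracket has weight 0 and hence lies in \<open>H\<close>. Its value under a root is
  an eigenvalue of its adjoint operator, so \<open>isotropic_bracket_nilpotent\<close> makes it 0,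
  and the roots separate points.\<close>

lemma isotropic_bracket_eq_0:
  assumes x: "x \<in> weight w" and y: "y \<in> weight u"
    and wu: "\<And>h. h \<in> H \<Longrightarrow> w h + u h = 0"
    and "killing_form (bracket x y) (bracket x y) = 0"
  shows "bracket x y = 0"
proof -
  let ?t = "bracket x y"
  have t: "?t \<in> H" using weight_bracket[OF x y] weight_eq_H[of "\<lambda>h. w h + u h"] wu by blast
  show ?thesis
  proof (rule roots_separate[OF t])
    fix \<beta> assume "\<beta> \<in> roots H"
    then obtain v where v: "v \<noteq> 0" "\<And>h. h \<in> H \<Longrightarrow> bracket h v = scale (\<beta> h) v"
      using root_vector by blast
    show "\<beta> ?t = 0"
    proof (rule isotropic_bracket_nilpotent[OF refl])
      show "x \<in> gen_eigenspace (bracket ?t) (w ?t)" "y \<in> gen_eigenspace (bracket ?t) (- w ?t)"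
        using weight_gen_eigenspace[OF x t] weight_gen_eigenspace[OF y t]
          minus_unique[OF wu[OF t]] by simp_all
      show "v \<in> gen_eigenspace (bracket ?t) (\<beta> ?t)"
        using eigenvector_gen_eigenspace[OF endo_bracket v(2)[OF t]] .
    qed (use v assms in auto)
  qed
qed

section \<open>Nondegeneracy of the Killing form\<close>

lemma exists_root: "\<exists>\<beta>. \<beta> \<in> roots H"
proof (rule ccontr)
  assume "\<nexists>\<beta>. \<beta> \<in> roots H"
  then have "H \<subseteq> {0}" using roots_separate by blast
  then have "H = {0}" using subspace_0[OF subspace_H] by blast
  \<comment> \<open>Everything normalizes the zero subalgebra, so self-normalization makes the whole
    algebra zero.\<close>
  then have "x = 0" for x :: 'g using normalizer[of x] by simp
  then show False using simple unfolding simple_def by metis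
qed

text \<open>If the Killing form vanished, all brackets of opposite weight spaces would vanish, and
  the nonzero weight spaces would span a nonzero ideal not containing \<open>H\<close>.\<close>

lemma killing_form_nonzero: "\<exists>x y. killing_form x y \<noteq> 0"
proof (rule ccontr)
  assume "\<nexists>x y. killing_form x y \<noteq> 0"
  then have killing_0: "killing_form x y = 0" for x y by blast
  define G where "G = (\<Union>w\<in>{w. \<exists>h\<in>H. w h \<noteq> 0}. weight w)"
  have G: "bracket x y \<in> span G" if xy: "x \<in> weight w" "y \<in> G" for x y w
  proof -
    obtain u where u: "y \<in> weight u" using xy(2) unfolding G_def by blast
    show ?thesis
    proof (cases "\<forall>h\<in>H. w h + u h = 0")
      case True
      then have "bracket x y = 0" using isotropic_bracket_eq_0[OF xy(1) u] killing_0 by blast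
      then show ?thesis by (simp add: span_zero)
    next
      case False
      then show ?thesis
        using weight_bracket[OF xy(1) u] unfolding G_def by (intro span_base) blast
    qed
  qed
  have "bracket x y \<in> span G" if "y \<in> span G" for x y
  proof -
    have "x \<in> span (\<Union>w. weight w)" by (simp add: span_weights)
    then show ?thesis
    proof (induction rule: span_induct_alt)
      case base
      then show ?case by (simp add: span_zero)
    next
      case (step c x z)
      then obtain w where x: "x \<in> weight w" by blast
      have "bracket x y \<in> span G"
        using that
      proof (induction rule: span_induct_alt)
        case base
        then show ?case by (simp add: span_zero)
      next
        case (step c y z)
        then show ?case using G[OF x]
          by (simp add: bracket_add_right bracket_scale_right span_add span_scale)
      qed
      then show ?case using step.IH
        by (simp add: bracket_add_left bracket_scale_left span_add span_scale)
    qed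
  qed
  then have "ideal (span G)" unfolding ideal_def by simp
  moreover obtain \<beta> where \<beta>: "\<beta> \<in> roots H" using exists_root by blast
  obtain v where v: "v \<noteq> 0" "\<And>h. h \<in> H \<Longrightarrow> bracket h v = scale (\<beta> h) v"
    using root_vector[OF \<beta>] by blast
  have "\<exists>h\<in>H. \<beta> h \<noteq> 0"
    using \<beta> dual_outside[OF roots_dual[OF \<beta>]] unfolding roots_def by (auto simp: fun_eq_iff)
  moreover have "v \<in> weight \<beta>"
    unfolding weight_space_def using eigenvector_gen_eigenspace[OF endo_bracket v(2)] by blast
  ultimately have "v \<in> span G" unfolding G_def by (intro span_base) blast
  with \<open>ideal (span G)\<close> v(1) have span_G: "span G = UNIV"
    using simple unfolding simple_def by blast
  \<comment> \<open>\<open>H\<close> is the zero weight space and meets the span of the nonzero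
    weight spaces only in 0.\<close>
  have "h = 0" if h: "h \<in> H" for h
  proof (rule weight_spaces_independent[where T = bracket and I = H and \<mu> = "\<lambda>_. 0"])
    show "h \<in> weight (\<lambda>_. 0)" using weight_eq_H[of "\<lambda>_. 0"] h by simp
    show "h \<in> span (\<Union>\<nu>\<in>{\<nu>. \<exists>i\<in>H. \<nu> i \<noteq> 0}. weight \<nu>)"
      using span_G unfolding G_def by simp
  qed (auto intro: endo_bracket ad_H_commute)
  then show False using \<open>\<exists>h\<in>H. \<beta> h \<noteq> 0\<close> dual_scale[OF roots_dual[OF \<beta>], of 0 0] by force
qed

text \<open>The radical of an invariant form is an ideal, and by \<open>killing_form_nonzero\<close>
  it is not everything.\<close>

lemma killing_form_nondegenerate:
  assumes "\<And>y. killing_form x y = 0"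
  shows "x = 0"
proof -
  let ?R = "{x. \<forall>y. killing_form x y = 0}"
  have "killing_form (bracket z x) y = 0" if "\<forall>y. killing_form x y = 0" for x y z
    using that killing_form_invariant[of x z y] bracket_antisym[of x z]
      killing_form_scale_left[of "- 1" "bracket z x" y] by simp
  then have "ideal ?R"
    unfolding ideal_def
    by (auto intro!: subspaceI simp: killing_form_add_left killing_form_scale_left)
  then have "?R = {0} \<or> ?R = UNIV" using simple unfolding simple_def by blast
  then show ?thesis using killing_form_nonzero assms by blast
qed

lemma killing_form_weight_witness:
  assumes "x \<noteq> 0"
  obtains w y where "y \<in> weight w" "killing_form x y \<noteq> 0"
proof -
  have "\<exists>w. \<exists>y\<in>weight w. killing_form x y \<noteq> 0"
  proof (rule ccontr)
    assume none: "\<not> ?thesis"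
    have "killing_form x y = 0" if "y \<in> span (\<Union>w. weight w)" for y
      using that
    proof (induction rule: span_induct_alt)
      case (step c z y)
      then show ?case using none by (auto simp: killing_form_add_right killing_form_scale_right)
    qed simp
    then show False using killing_form_nondegenerate assms span_weights by blast
  qed
  then show ?thesis using that by blast
qed

text \<open>An element of \<open>H\<close> is orthogonal to all weight vectors of nonzero weight, so
  a weight vector witnessing nondegeneracy on the whole algebra already lies in
  \<open>H\<close>.\<close>

lemma killing_form_H_nondegenerate:
  assumes "x \<in> H" "\<And>y. y \<in> H \<Longrightarrow> killing_form x y = 0"
  shows "x = 0"
proof (rule ccontr)
  assume "x \<noteq> 0"
  then obtain w y where y: "y \<in> weight w" "killing_form x y \<noteq> 0"
    using killing_form_weight_witness by blast
  have "w h = 0" if "h \<in> H" for h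
    using killing_form_eigen_orthogonal[of h x 0 y "w h"] weight_gen_eigenspace[OF y(1) that]
      H_abelian[OF that assms(1)] y(2) by auto
  then show False using weight_eq_H[of w] y assms(2) by blast
qed

end

section \<open>Coxeter elements\<close>

context simple_lie_algebra
begin

text \<open>The map \<open>\<Phi>\<close> from \<open>H\<close> to \<open>dual H\<close> is
  injective by nondegeneracy, and onto by counting: \<open>dual H\<close> is spanned by
  \<open>dim H\<close> simple roots, too few for \<open>\<xi>\<close> to be independent of the image
  of a basis. Together these give the unique existence that the \<open>THE\<close> in
  \<open>killing_dual\<close> asks for.\<close>

lemma killing_dual_props:
  assumes \<xi>: "\<xi> \<in> dual H"
  shows "killing_dual H \<xi> \<in> H" "\<And>x. x \<in> H \<Longrightarrow> killing_form (killing_dual H \<xi>) x = \<xi> x"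
proof -
  interpret pair: vector_space_pair scale fun_scale ..
  obtain B where B: "finite B" "independent B" "B \<subseteq> H" "span B = H" "card B = dim H"
    using finite_basis_H by blast
  define \<Phi> where "\<Phi> t = (\<lambda>x. if x \<in> H then killing_form t x else 0)" for t
  have lin: "Vector_Spaces.linear scale fun_scale \<Phi>"
    by (intro Vector_Spaces.linear.intro module_hom.intro module_hom_axioms.intro
        vector_space_axioms module_axioms fun_space.vector_space_axioms fun_space.module_axioms)
      (auto simp: \<Phi>_def fun_scale_def fun_eq_iff killing_form_add_left killing_form_scale_left)
  have dual: "\<Phi> t \<in> dual H" for t
    unfolding dual_def \<Phi>_def
    by (simp add: killing_form_add_right killing_form_scale_right subspace_add[OF subspace_H]
        subspace_scale[OF subspace_H])
  have inj: "inj_on \<Phi> H"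
  proof (rule inj_onI)
    fix s t assume st: "s \<in> H" "t \<in> H" "\<Phi> s = \<Phi> t"
    have "killing_form (s - t) y = 0" if "y \<in> H" for y
      using fun_cong[OF st(3), of y] that by (simp add: \<Phi>_def killing_form_diff_left)
    then have "s - t = 0"
      using killing_form_H_nondegenerate subspace_diff[OF subspace_H] st by blast
    then show "s = t" by simp
  qed
  have ind: "fun_space.independent (\<Phi> ` B)"
    by (rule pair.linear_independent_injective_image[OF lin B(2)]) (simp add: B(4) inj)
  have "\<xi> \<in> fun_space.span (\<Phi> ` B)"
  proof (rule ccontr)
    assume not: "\<xi> \<notin> fun_space.span (\<Phi> ` B)"
    then have "fun_space.independent (insert \<xi> (\<Phi> ` B))"
      using ind by (rule fun_space.independent_insertI)
    moreover have "insert \<xi> (\<Phi> ` B) \<subseteq> fun_space.span (\<alpha> ` {..<dim H})"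
      using \<xi> dual by (auto simp: span_\<alpha>)
    ultimately have "card (insert \<xi> (\<Phi> ` B)) \<le> card (\<alpha> ` {..<dim H})"
      using fun_space.independent_span_bound[of "\<alpha> ` {..<dim H}"] by blast
    moreover have "\<xi> \<notin> \<Phi> ` B" using not fun_space.span_base by blast
    moreover have "card (\<Phi> ` B) = dim H"
      using card_image[OF inj_on_subset[OF inj B(3)]] B(5) by simp
    ultimately show False using B(1) card_image[OF inj_\<alpha>] by simp
  qed
  then have "\<xi> \<in> \<Phi> ` H" using pair.linear_span_image[OF lin, of B] B(4) by simp
  then obtain t where t: "t \<in> H" "\<xi> = \<Phi> t" by blast
  have "\<exists>!t. t \<in> H \<and> (\<forall>x\<in>H. killing_form t x = \<xi> x)"
  proof (rule ex1I[of _ t])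
    show "t \<in> H \<and> (\<forall>x\<in>H. killing_form t x = \<xi> x)" using t by (simp add: \<Phi>_def)
    fix s assume s: "s \<in> H \<and> (\<forall>x\<in>H. killing_form s x = \<xi> x)"
    then have "\<Phi> s = \<Phi> t" using t by (auto simp: \<Phi>_def fun_eq_iff)
    then show "s = t" using inj s t(1) by (auto dest: inj_onD)
  qed
  from theI'[OF this] show "killing_dual H \<xi> \<in> H"
    "\<And>x. x \<in> H \<Longrightarrow> killing_form (killing_dual H \<xi>) x = \<xi> x"
    unfolding killing_dual_def by blast+
qed

lemma dual_form_eq:
  assumes "\<xi> \<in> dual H" "\<mu> \<in> dual H"
  shows "dual_form H \<xi> \<mu> = \<xi> (killing_dual H \<mu>)"
  unfolding dual_form_def using killing_dual_props assms by blast

text \<open>For a root vector \<open>x\<close> of \<open>\<gamma>\<close> and \<open>y\<close> of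
  opposite weight, \<open>bracket x y\<close> is \<open>killing_form x y\<close> times the element
  dual to \<open>\<gamma>\<close>. \<open>eigenvalue_real_multiple\<close> compares the values of
  \<open>\<beta>\<close> and \<open>\<gamma>\<close> at this bracket, and the nonzero factor
  cancels.\<close>

lemma root_ratio_real:
  assumes \<beta>: "\<beta> \<in> roots H" and \<gamma>: "\<gamma> \<in> roots H"
  shows "\<exists>r::real. dual_form H \<beta> \<gamma> = of_real r * dual_form H \<gamma> \<gamma>"
proof -
  obtain x where x: "x \<noteq> 0" "\<And>h. h \<in> H \<Longrightarrow> bracket h x = scale (\<gamma> h) x"
    using root_vector[OF \<gamma>] by blast
  obtain w y where y: "y \<in> weight w" "killing_form x y \<noteq> 0"
    using killing_form_weight_witness[OF x(1)] by blast
  let ?t = "bracket x y" and ?s = "killing_dual H \<gamma>" and ?k = "killing_form x y"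
  have x_weight: "x \<in> weight \<gamma>"
    unfolding weight_space_def using eigenvector_gen_eigenspace[OF endo_bracket x(2)] by blast
  have opposite: "\<gamma> h + w h = 0" if "h \<in> H" for h
    using killing_form_eigen_orthogonal[OF x(2)[OF that] weight_gen_eigenspace[OF y(1) that]] y(2)
    by blast
  have t: "?t \<in> H"
    using weight_bracket[OF x_weight y(1)] weight_eq_H[of "\<lambda>h. \<gamma> h + w h"] opposite by blast
  have s: "?s \<in> H" "\<And>h. h \<in> H \<Longrightarrow> killing_form ?s h = \<gamma> h"
    using killing_dual_props[OF roots_dual[OF \<gamma>]] by auto
  have "killing_form (?t - scale ?k ?s) h = 0" if h: "h \<in> H" for h
  proof -
    have "killing_form ?t h = killing_form (bracket h x) y"
      using killing_form_sym[of ?t h] killing_form_invariant[of h x y] by simp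
    then show ?thesis
      by (simp add: x(2)[OF h] s(2)[OF h] killing_form_diff_left killing_form_scale_left)
  qed
  then have "?t - scale ?k ?s = 0"
    using killing_form_H_nondegenerate subspace_diff[OF subspace_H t]
      subspace_scale[OF subspace_H s(1)] by blast
  then have t_eq: "?t = scale ?k ?s" by simp
  obtain v where v: "v \<noteq> 0" "\<And>h. h \<in> H \<Longrightarrow> bracket h v = scale (\<beta> h) v"
    using root_vector[OF \<beta>] by blast
  have "y \<in> gen_eigenspace (bracket ?t) (- \<gamma> ?t)"
    using weight_gen_eigenspace[OF y(1) t] minus_unique[OF opposite[OF t]] by simp
  then obtain r :: real where r: "\<beta> ?t = of_real r * \<gamma> ?t"
    using eigenvalue_real_multiple[OF refl weight_gen_eigenspace[OF x_weight t] _
        eigenvector_gen_eigenspace[OF endo_bracket v(2)[OF t]] v(1)] by blast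
  then have "\<beta> ?s = of_real r * \<gamma> ?s"
    using y(2) dual_scale[OF roots_dual[OF \<beta>] s(1)] dual_scale[OF roots_dual[OF \<gamma>] s(1)]
    unfolding t_eq by simp
  then show ?thesis using dual_form_eq roots_dual \<beta> \<gamma> by auto
qed

definition cartan_entry :: "nat \<Rightarrow> nat \<Rightarrow> complex"
  where "cartan_entry i j = 2 * dual_form H (\<alpha> i) (\<alpha> j) / dual_form H (\<alpha> j) (\<alpha> j)"

lemma cartan_entry_real:
  assumes "i < dim H" "j < dim H"
  shows "cartan_entry i j \<in> \<real>"
proof -
  obtain r where r: "dual_form H (\<alpha> i) (\<alpha> j) = of_real r * dual_form H (\<alpha> j) (\<alpha> j)"
    using root_ratio_real roots_\<alpha> assms by blast
  \<comment> \<open>A zero denominator makes the quotient 0, which is real as well.\<close>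
  show ?thesis unfolding cartan_entry_def r by (cases "dual_form H (\<alpha> j) (\<alpha> j) = 0") auto
qed

section \<open>Simple reflections in simple-root coordinates\<close>

definition root_comb :: "(nat \<Rightarrow> complex) \<Rightarrow> 'g \<Rightarrow> complex"
  where "root_comb x = (\<Sum>i<dim H. fun_scale (x i) (\<alpha> i))"

lemma root_comb_dual: "root_comb x \<in> dual H"
  unfolding root_comb_def span_\<alpha>[symmetric]
  by (intro fun_space.span_sum fun_space.span_scale fun_space.span_base) auto

lemma root_comb_apply: "root_comb x t = (\<Sum>i<dim H. x i * \<alpha> i t)"
proof -
  have "(\<Sum>i\<in>I. fun_scale (x i) (\<alpha> i)) t = (\<Sum>i\<in>I. x i * \<alpha> i t)" for I
    by (induction I rule: infinite_finite_induct) (simp_all add: fun_scale_def)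
  then show ?thesis by (simp add: root_comb_def)
qed

lemma representation_root_comb:
  assumes "i < dim H"
  shows "fun_space.representation (\<alpha> ` {..<dim H}) (root_comb x) (\<alpha> i) = x i"
proof -
  let ?A = "\<alpha> ` {..<dim H}"
  have base: "\<alpha> j \<in> fun_space.span ?A" if "j \<in> {..<dim H}" for j
    using that by (intro fun_space.span_base) auto
  have eq: "\<alpha> i = \<alpha> j \<longleftrightarrow> i = j" if "j \<in> {..<dim H}" for j
    using inj_\<alpha> assms that by (auto dest: inj_onD)
  have "fun_space.representation ?A (root_comb x) (\<alpha> i)
      = (\<Sum>j<dim H. x j * fun_space.representation ?A (\<alpha> j) (\<alpha> i))"
    unfolding root_comb_def
    by (subst fun_space.representation_sum[OF independent_\<alpha>])
      (auto intro!: fun_space.span_scale base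
        simp: fun_space.representation_scale[OF independent_\<alpha> base])
  also have "\<dots> = (\<Sum>j<dim H. if j = i then x j else 0)"
    by (rule sum.cong) (auto simp: fun_space.representation_basis[OF independent_\<alpha>] eq)
  finally show ?thesis using assms by simp
qed

end

text \<open>The simple reflection at index \<open>k\<close>, acting on simple-root coordinates. It
  is separated from the Lie algebra so that the determinant identity becomes a statement about
  arbitrary matrices.\<close>

definition coxeter_step :: "nat \<Rightarrow> (nat \<Rightarrow> nat \<Rightarrow> 'a :: comm_ring_1) \<Rightarrow> nat \<Rightarrow> (nat \<Rightarrow> 'a) \<Rightarrow> nat \<Rightarrow> 'a"
  where "coxeter_step n C k x = x(k := x k - (\<Sum>i<n. x i * C i k))"

definition unit_coords :: "nat \<Rightarrow> nat \<Rightarrow> 'a :: comm_ring_1"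
  where "unit_coords j i = (if i = j then 1 else 0)"

definition coxeter_mat :: "nat \<Rightarrow> (nat \<Rightarrow> nat \<Rightarrow> 'a :: comm_ring_1) \<Rightarrow> nat list \<Rightarrow> 'a mat"
  where "coxeter_mat n C p = mat n n (\<lambda>(i, j). foldr (coxeter_step n C) p (unit_coords j) i)"

context simple_lie_algebra
begin

lemma reflection_root_comb:
  assumes "k < dim H"
  shows "reflection H (\<alpha> k) (root_comb x) = root_comb (coxeter_step (dim H) cartan_entry k x)"
proof
  fix t
  let ?s = "\<Sum>i<dim H. x i * cartan_entry i k"
  have \<alpha>_dual: "\<alpha> i \<in> dual H" if "i < dim H" for i
    using roots_\<alpha>[OF that] by (rule roots_dual)
  have "2 * dual_form H (root_comb x) (\<alpha> k) / dual_form H (\<alpha> k) (\<alpha> k) = ?s"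
    using assms
    by (simp add: dual_form_eq root_comb_dual \<alpha>_dual root_comb_apply cartan_entry_def
        sum_distrib_left sum_divide_distrib mult.left_commute)
  moreover have "root_comb (coxeter_step (dim H) cartan_entry k x) t = root_comb x t - ?s * \<alpha> k t"
  proof -
    have "root_comb (coxeter_step (dim H) cartan_entry k x) t
        = (\<Sum>i<dim H. x i * \<alpha> i t - (if i = k then ?s * \<alpha> k t else 0))"
      unfolding root_comb_apply by (rule sum.cong) (auto simp: coxeter_step_def algebra_simps)
    then show ?thesis using assms by (simp add: sum_subtractf root_comb_apply)
  qed
  ultimately show "reflection H (\<alpha> k) (root_comb x) t
      = root_comb (coxeter_step (dim H) cartan_entry k x) t"
    by (simp add: reflection_def fun_scale_def)
qed

lemma coxeter_product_root_comb:
  assumes "set p \<subseteq> {..<dim H}"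
  shows "foldr (\<lambda>i f. reflection H (\<alpha> i) \<circ> f) p id (root_comb x)
    = root_comb (foldr (coxeter_step (dim H) cartan_entry) p x)"
  using assms by (induction p) (auto simp: reflection_root_comb)

lemma simple_root_matrix_coxeter_element:
  assumes "coxeter_element H \<alpha> c"
  obtains p where "distinct p" "set p = {..<dim H}"
    "simple_root_matrix H \<alpha> c = coxeter_mat (dim H) cartan_entry p"
proof -
  obtain p where p: "distinct p" "set p = {..<dim H}"
    "c = foldr (\<lambda>i f. reflection H (\<alpha> i) \<circ> f) p id"
    using assms unfolding coxeter_element_def by blast
  have "\<alpha> j = root_comb (unit_coords j)" if "j < dim H" for j
    using that by (intro ext) (simp add: root_comb_apply unit_coords_def if_distrib[of "\<lambda>a. a * _"]
        cong: if_cong)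
  then have "c (\<alpha> j) = root_comb (foldr (coxeter_step (dim H) cartan_entry) p (unit_coords j))"
    if "j < dim H" for j
    using coxeter_product_root_comb[of p] p that by simp
  then have "simple_root_matrix H \<alpha> c = coxeter_mat (dim H) cartan_entry p"
    unfolding simple_root_matrix_def coxeter_mat_def
    by (intro eq_matI) (simp_all add: representation_root_comb)
  then show ?thesis using that p by blast
qed

lemma cartan_matrix_eq: "cartan_matrix H \<alpha> = mat (dim H) (dim H) (\<lambda>(i, j). cartan_entry i j)"
  unfolding cartan_matrix_def cartan_entry_def ..

end

section \<open>The Gauss-Seidel sweep and the determinant of 1 - c\<close>

lemma foldr_coxeter_step_outside:
  "k \<notin> set p \<Longrightarrow> foldr (coxeter_step n C) p x k = x k"
  by (induction p) (auto simp: coxeter_step_def)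

lemma foldr_coxeter_step_real:
  assumes "\<And>i j. i < n \<Longrightarrow> j < n \<Longrightarrow> C i j \<in> (\<real> :: 'a :: {real_algebra_1, comm_ring_1} set)"
    and "set p \<subseteq> {..<n}" "\<And>i. x i \<in> \<real>"
  shows "foldr (coxeter_step n C) p x i \<in> \<real>"
  using assms(2)
proof (induction p arbitrary: i)
  case (Cons k p)
  then have "(\<Sum>i<n. foldr (coxeter_step n C) p x i * C i k) \<in> \<real>"
    using assms(1) by (intro sum_in_Reals Reals_mult) auto
  then show ?case
    using Cons coxeter_step_def[of n C k "foldr (coxeter_step n C) p x"] by (auto intro: Reals_diff)
qed (use assms in simp)

text \<open>\<open>foldr\<close> applies the last entry of the list first, so the entries to the
  right of \<open>k\<close> are the coordinates already overwritten when the turn of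
  \<open>k\<close> comes.\<close>

fun applied_before :: "nat list \<Rightarrow> nat \<Rightarrow> nat set"
  where
    "applied_before [] k = {}"
  | "applied_before (i # p) k = (if i = k then set p else applied_before p k)"

lemma applied_before_subset: "applied_before p k \<subseteq> set p"
  by (induction p) auto

lemma applied_before_irrefl: "distinct p \<Longrightarrow> k \<notin> applied_before p k"
  by (induction p) auto

text \<open>The reflections in the list are applied from the right, each one overwriting a single
  coordinate, as in a Gauss--Seidel sweep.\<close>

lemma foldr_coxeter_step_sweep:
  assumes "distinct p" "k \<in> set p"
  shows "foldr (coxeter_step n C) p x k
    = x k - (\<Sum>i<n. (if i \<in> applied_before p k then foldr (coxeter_step n C) p x i else x i) * C i k)"
  using assms
proof (induction p)
  case (Cons j p)
  let ?y = "foldr (coxeter_step n C) p x"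
  have same: "foldr (coxeter_step n C) (j # p) x i = ?y i" if "i \<noteq> j" for i
    using that by (simp add: coxeter_step_def)
  show ?case
  proof (cases "k = j")
    case True
    have "?y i = (if i \<in> set p then foldr (coxeter_step n C) (j # p) x i else x i)" for i
      using Cons.prems(1) same[of i] foldr_coxeter_step_outside[of i p n C x] by (cases "i = j") auto
    then have "(\<Sum>i<n. ?y i * C i k)
        = (\<Sum>i<n. (if i \<in> set p then foldr (coxeter_step n C) (j # p) x i else x i) * C i k)"
      by presburger
    moreover have "foldr (coxeter_step n C) (j # p) x k = ?y k - (\<Sum>i<n. ?y i * C i k)"
      using True by (simp add: coxeter_step_def)
    moreover have "?y k = x k"
      using Cons.prems(1) True foldr_coxeter_step_outside by auto
    ultimately show ?thesis using True by simp
  next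
    case False
    have "(if i \<in> applied_before p k then ?y i else x i)
        = (if i \<in> applied_before p k then foldr (coxeter_step n C) (j # p) x i else x i)" for i
      using same[of i] applied_before_subset[of p k] Cons.prems(1) by (cases "i = j") auto
    then have "(\<Sum>i<n. (if i \<in> applied_before p k then ?y i else x i) * C i k)
        = (\<Sum>i<n. (if i \<in> applied_before p k then foldr (coxeter_step n C) (j # p) x i else x i) * C i k)"
      by presburger
    then show ?thesis
      using False Cons.IH Cons.prems same[of k] by simp
  qed
qed simp


text \<open>This is unitriangularity in the order of \<open>p\<close>, in the form that the Leibniz
  formula uses. The head of the list is applied last and lies in no \<open>applied_before\<close>
  set, so its preimage under \<open>\<pi>\<close> can only be itself; the tail follows by
  induction.\<close>

lemma permutes_applied_before_eq_id:
  assumes "distinct p" "\<pi> permutes set p" "\<And>k. k \<in> set p \<Longrightarrow> \<pi> k = k \<or> \<pi> k \<in> applied_before p k"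
  shows "\<pi> = id"
  using assms
proof (induction p)
  case (Cons j p)
  have notin: "j \<notin> applied_before p k" for k
    using applied_before_subset[of p k] Cons.prems(1) by auto
  obtain k where k: "k \<in> set (j # p)" "\<pi> k = j"
    using permutes_image[OF Cons.prems(2)] by (metis imageE list.set_intros(1))
  have "k = j"
  proof (rule ccontr)
    assume "k \<noteq> j"
    then show False using Cons.prems(3)[OF k(1)] k(2) notin[of k] by auto
  qed
  then have fix_j: "\<pi> j = j" using k(2) by simp
  then have "\<pi> permutes set p"
    using permutes_superset[OF Cons.prems(2), of "set p"] by auto
  moreover have "\<pi> k = k \<or> \<pi> k \<in> applied_before p k" if "k \<in> set p" for k
    using Cons.prems(1) Cons.prems(3)[of k] that by (cases "j = k") auto
  ultimately show ?case using Cons.IH Cons.prems(1) by simp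
qed simp

lemma det_one_minus_coxeter_mat:
  fixes C :: "nat \<Rightarrow> nat \<Rightarrow> 'a :: idom"
  assumes p: "distinct p" "set p = {..<n}"
  shows "det (1\<^sub>m n - coxeter_mat n C p) = det (mat n n (\<lambda>(i, j). C i j))"
proof -
  \<comment> \<open>Row \<open>k\<close> is the sweep equation for coordinate \<open>k\<close> with
    the terms of the already overwritten coordinates brought to the left. They carry the coefficient
    \<open>C i k\<close>, whence the transpose below.\<close>
  define U where "U = mat n n (\<lambda>(k, i). if i = k then 1 else if i \<in> applied_before p k then C i k else 0)"
  let ?M = "coxeter_mat n C p" and ?A = "mat n n (\<lambda>(i, j). C i j)"
  have U: "U \<in> carrier_mat n n" and M: "?M \<in> carrier_mat n n" and A: "?A \<in> carrier_mat n n"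
    by (simp_all add: U_def coxeter_mat_def)
  have "U * (1\<^sub>m n - ?M) = transpose_mat ?A"
  proof (rule eq_matI)
    fix k j assume "k < dim_row (transpose_mat ?A)" "j < dim_col (transpose_mat ?A)"
    then have kj: "k < n" "j < n" by auto
    let ?x = "unit_coords j :: nat \<Rightarrow> 'a"
    let ?y = "foldr (coxeter_step n C) p ?x" and ?B = "applied_before p k"
    have "(U * (1\<^sub>m n - ?M)) $$ (k, j)
        = (\<Sum>i<n. (if i = k then 1 else if i \<in> ?B then C i k else 0) * (?x i - ?y i))"
      using kj by (simp add: U_def coxeter_mat_def scalar_prod_def unit_coords_def lessThan_atLeast0)
    \<comment> \<open>The factor in front of \<open>C i k\<close> is \<open>?x i - ?y i\<close> for
      \<open>i\<close> in \<open>?B\<close> and 0 otherwise; the term \<open>i = k\<close> stands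
      apart because \<open>k\<close> is not in \<open>?B\<close>.\<close>
    also have "\<dots> = (\<Sum>i<n. (if i = k then ?x i - ?y i else 0)
        + (?x i - (if i \<in> ?B then ?y i else ?x i)) * C i k)"
      using applied_before_irrefl[OF p(1)] by (intro sum.cong) (auto simp: algebra_simps)
    also have "\<dots> = (?x k - ?y k) + (\<Sum>i<n. ?x i * C i k)
        - (\<Sum>i<n. (if i \<in> ?B then ?y i else ?x i) * C i k)"
      using kj by (simp add: sum.distrib left_diff_distrib sum_subtractf)
    also have "\<dots> = (\<Sum>i<n. ?x i * C i k)"
      using foldr_coxeter_step_sweep[OF p(1), of k n C ?x] kj p(2) by simp
    also have "\<dots> = C j k"
      using kj by (simp add: unit_coords_def if_distrib[of "\<lambda>a. a * _"] cong: if_cong)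
    finally show "(U * (1\<^sub>m n - ?M)) $$ (k, j) = transpose_mat ?A $$ (k, j)" using kj by simp
  qed (simp_all add: U_def coxeter_mat_def)
  then have "det U * det (1\<^sub>m n - ?M) = det ?A"
    using det_mult[OF U minus_carrier_mat[OF M], of "1\<^sub>m n"] det_transpose[OF A] by simp
  moreover have "det U = 1"
  proof -
    let ?f = "\<lambda>\<pi>. signof \<pi> * (\<Prod>k = 0..<n. U $$ (k, \<pi> k))"
    have "?f \<pi> = 0" if \<pi>: "\<pi> permutes {0..<n}" "\<pi> \<noteq> id" for \<pi>
    proof -
      obtain k where k: "k < n" "\<pi> k \<noteq> k" "\<pi> k \<notin> applied_before p k"
        using permutes_applied_before_eq_id[OF p(1), of \<pi>] \<pi> p(2) by (auto simp: lessThan_atLeast0)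
      then have "U $$ (k, \<pi> k) = 0"
        using permutes_in_image[OF \<pi>(1), of k] by (simp add: U_def)
      then show ?thesis using k(1) by (auto intro!: prod_zero)
    qed
    moreover have "?f id = 1" by (simp add: U_def)
    ultimately have "(\<Sum>\<pi> | \<pi> permutes {0..<n}. ?f \<pi>) = (\<Sum>\<pi> | \<pi> permutes {0..<n}. if \<pi> = id then 1 else 0)"
      by (intro sum.cong) auto
    then show ?thesis
      using det_def'[OF U] permutes_id[of "{0..<n}"] finite_permutations[of "{0..<n}"] by simp
  qed
  ultimately show ?thesis by simp
qed

text \<open>Evaluation at \<open>a\<close> is a ring homomorphism and so commutes with
  \<open>det\<close>. The value \<open>a = 1\<close> will turn the product over the eigenvalues into
  det (1 - c).\<close>

lemma poly_char_poly:
  fixes A :: "'a :: comm_ring_1 mat"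
  assumes "A \<in> carrier_mat n n"
  shows "poly (char_poly A) a = det (a \<cdot>\<^sub>m 1\<^sub>m n - A)"
proof -
  have "map_mat (\<lambda>p. poly p a) (char_poly_matrix A) = a \<cdot>\<^sub>m 1\<^sub>m n - A"
    using assms by (intro eq_matI) (auto simp: char_poly_matrix_def)
  moreover have "comm_ring_hom (\<lambda>p :: 'a poly. poly p a)" by unfold_locales auto
  ultimately show ?thesis
    using comm_ring_hom.hom_det[of "\<lambda>p :: 'a poly. poly p a" "char_poly_matrix A"]
    by (simp add: char_poly_def)
qed

section \<open>Exponents\<close>

lemma proots_prod_linear_factors:
  "proots (\<Prod>i\<in>I. [:- (z i :: 'a :: field), 1:]) = image_mset z (mset_set I)"
proof -
  have "proots (\<Prod>i\<in>I. [:- z i, 1:]) = (\<Sum>i\<in>I. {#z i#})"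
    by (subst proots_prod) auto
  also have "\<dots> = image_mset z (mset_set I)"
    by (induction I rule: infinite_finite_induct) auto
  finally show ?thesis .
qed

text \<open>For a real polynomial complex conjugation permutes the roots, i.e. \<open>m\<close> and \<open>h - m\<close> have the
  same distribution. With \<open>w = exp (\<pi> \<i> m / h)\<close> this turns \<open>\<Prod>(1 - w\<^sup>2) = \<Prod>(1 - w) (1 + w)\<close> into
  \<open>\<Prod>(1 - w) (1 - cnj w)\<close>.\<close>

lemma poly_at_1_eq_prod_sin:
  fixes m :: "nat \<Rightarrow> nat" and h l :: nat
  defines "P \<equiv> \<Prod>i<l. [:- cis (2 * pi * m i / h), 1:]"
  assumes m: "\<And>i. i < l \<Longrightarrow> 1 \<le> m i \<and> m i < h" and real: "map_poly cnj P = P"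
  shows "poly P 1 = of_real (2 ^ (2 * l) * (\<Prod>i<l. (sin (m i * pi / (2 * h)))\<^sup>2))"
proof -
  define e where "e k = cis (2 * pi * real k / real h)" for k :: nat
  define M where "M = mset_set {..<l}"
  have e_inj: "inj_on e {..<h}"
  proof (cases "h > 0")
    case True
    from bij_betw_imp_inj_on[OF bij_betw_roots_unity[OF this]] show ?thesis unfolding e_def .
  qed simp
  have cnj_e: "cnj (e (m i)) = e (h - m i)" if "i < l" for i
  proof -
    have "h > 0" using m[OF that] by linarith
    then have "2 * pi * real (h - m i) / real h = 2 * pi - 2 * pi * real (m i) / real h"
      using m[OF that] by (simp add: of_nat_diff field_simps)
    then show ?thesis unfolding e_def by (simp add: complex_eq_iff)
  qed
  interpret cnj: comm_ring_hom cnj by unfold_locales auto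
  interpret cnj_poly: map_poly_comm_ring_hom cnj ..
  have P: "P = (\<Prod>i<l. [:- e (m i), 1:])" by (simp add: P_def e_def)
  have "map_poly cnj P = (\<Prod>i<l. [:- cnj (e (m i)), 1:])"
    unfolding P by (simp add: cnj_poly.hom_prod)
  also have "\<dots> = (\<Prod>i<l. [:- e (h - m i), 1:])"
    by (rule prod.cong) (simp_all add: cnj_e)
  finally have "(\<Prod>i<l. [:- e (m i), 1:]) = (\<Prod>i<l. [:- e (h - m i), 1:])"
    using real P by simp
  then have "image_mset (\<lambda>i. e (m i)) M = image_mset (\<lambda>i. e (h - m i)) M"
    unfolding M_def by (metis proots_prod_linear_factors)
  \<comment> \<open>Inverting \<open>e\<close> brings the symmetry from the eigenvalues down to the
    integers, on which the half angles below depend. Both \<open>m i\<close> and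
    \<open>h - m i\<close> lie below \<open>h\<close>, the latter because
    \<open>1 \<le> m i\<close>.\<close>
  then have "image_mset (inv_into {..<h} e) (image_mset (\<lambda>i. e (m i)) M)
      = image_mset (inv_into {..<h} e) (image_mset (\<lambda>i. e (h - m i)) M)"
    by simp
  moreover have "image_mset (inv_into {..<h} e) (image_mset (\<lambda>i. e (m i)) M) = image_mset m M"
    unfolding multiset.map_comp using m
    by (intro image_mset_cong) (auto simp: M_def intro!: inv_into_f_f e_inj)
  moreover have "image_mset (inv_into {..<h} e) (image_mset (\<lambda>i. e (h - m i)) M)
      = image_mset (\<lambda>i. h - m i) M"
    unfolding multiset.map_comp
    by (intro image_mset_cong) (auto simp: M_def dest!: m intro!: inv_into_f_f e_inj)
  ultimately have sym: "image_mset m M = image_mset (\<lambda>i. h - m i) M" by simp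
  \<comment> \<open>This square root of \<open>e k\<close> is chosen so that
    \<open>w (h - m i) = - cnj (w (m i))\<close>, which matches the symmetry of the
    exponents.\<close>
  define w where "w k = cis (pi * real k / real h)" for k :: nat
  have "(\<Prod>i<l. 1 + w (m i)) = prod_mset (image_mset (\<lambda>k. 1 + w k) (image_mset m M))"
    by (simp add: M_def prod_unfold_prod_mset multiset.map_comp comp_def)
  also have "\<dots> = (\<Prod>i<l. 1 + w (h - m i))"
    unfolding sym by (simp add: M_def prod_unfold_prod_mset multiset.map_comp comp_def)
  also have "\<dots> = (\<Prod>i<l. 1 - cnj (w (m i)))"
  proof (rule prod.cong[OF refl])
    fix i assume "i \<in> {..<l}"
    then have mi: "1 \<le> m i" "m i < h" using m by auto
    then have "pi * real (h - m i) / real h = pi - pi * real (m i) / real h"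
      by (simp add: of_nat_diff field_simps)
    then show "1 + w (h - m i) = 1 - cnj (w (m i))"
      unfolding w_def by (simp add: complex_eq_iff)
  qed
  finally have half: "(\<Prod>i<l. 1 + w (m i)) = (\<Prod>i<l. 1 - cnj (w (m i)))" .
  have "poly P 1 = (\<Prod>i<l. 1 - e (m i))"
    unfolding P_def e_def by (simp add: poly_prod)
  also have "\<dots> = (\<Prod>i<l. (1 - w (m i)) * (1 + w (m i)))"
  proof (rule prod.cong[OF refl])
    fix i
    have "e (m i) = w (m i) * w (m i)" unfolding e_def w_def by (simp add: cis_mult mult.assoc)
    then show "1 - e (m i) = (1 - w (m i)) * (1 + w (m i))" by (simp add: algebra_simps)
  qed
  also have "\<dots> = (\<Prod>i<l. (1 - w (m i)) * (1 - cnj (w (m i))))"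
    by (simp add: prod.distrib half)
  also have "\<dots> = (\<Prod>i<l. of_real (4 * (sin (m i * pi / (2 * h)))\<^sup>2))"
  proof (rule prod.cong[OF refl])
    fix i
    let ?\<theta> = "pi * real (m i) / real h"
    have "(1 - w (m i)) * (1 - cnj (w (m i))) = of_real ((cmod (1 - w (m i)))\<^sup>2)"
      using complex_norm_square[of "1 - w (m i)"] by simp
    also have "(cmod (1 - w (m i)))\<^sup>2 = (1 - cos ?\<theta>)\<^sup>2 + (sin ?\<theta>)\<^sup>2"
      by (simp add: cmod_power2 w_def)
    also have "\<dots> = 2 - 2 * cos ?\<theta>"
      using sin_cos_squared_add[of ?\<theta>] by (simp add: power2_eq_square algebra_simps)
    also have "\<dots> = 4 * (sin (?\<theta> / 2))\<^sup>2"
      using cos_double_sin[of "?\<theta> / 2"] by simp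
    finally show "(1 - w (m i)) * (1 - cnj (w (m i))) = of_real (4 * (sin (m i * pi / (2 * h)))\<^sup>2)"
      by (simp add: mult.commute)
  qed
  also have "\<dots> = of_real (2 ^ (2 * l) * (\<Prod>i<l. (sin (m i * pi / (2 * h)))\<^sup>2))"
    by (simp add: prod.distrib power_mult)
  finally show ?thesis .
qed

theorem theorem2:
  fixes scale :: "complex \<Rightarrow> 'g :: ab_group_add \<Rightarrow> 'g"
    and bracket :: "'g \<Rightarrow> 'g \<Rightarrow> 'g"
    and H :: "'g set"
    and \<alpha> :: "nat \<Rightarrow> 'g \<Rightarrow> complex"
    and l h :: nat
    and m :: "nat \<Rightarrow> nat"
  assumes "complex_lie_algebra scale bracket"
    and "complex_lie_algebra.simple scale bracket"
    and "complex_lie_algebra.cartan_subalgebra scale bracket H"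
    and "l = vector_space.dim scale H"
    and "complex_lie_algebra.simple_roots scale bracket H \<alpha>"
    and "complex_lie_algebra.coxeter_number scale bracket H \<alpha> h"
    and "complex_lie_algebra.exponents scale bracket H \<alpha> h m"
  shows "of_real (2 ^ (2 * l) * (\<Prod>i<l. (sin (real (m i) * pi / (2 * real h)))\<^sup>2))
    = det (complex_lie_algebra.cartan_matrix scale bracket H \<alpha>)"
proof -
  interpret simple_lie_algebra scale bracket H \<alpha>
    using assms(1,2,3,5) by (intro simple_lie_algebra.intro simple_lie_algebra_axioms.intro)
  have l: "l = dim H" by (rule assms(4))
  obtain c where m: "\<And>i. i < l \<Longrightarrow> 1 \<le> m i \<and> m i < h" and c: "coxeter_element H \<alpha> c"
    and char_poly: "char_poly (simple_root_matrix H \<alpha> c)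
      = (\<Prod>i<l. [:- exp (2 * of_real pi * \<i> * of_nat (m i) / of_nat h), 1:])"
    using assms(7) unfolding exponents_def l by blast
  obtain p where p: "distinct p" "set p = {..<l}"
    "simple_root_matrix H \<alpha> c = coxeter_mat l cartan_entry p"
    using simple_root_matrix_coxeter_element[OF c] l by blast
  let ?M = "coxeter_mat l cartan_entry p"
  let ?P = "\<Prod>i<l. [:- cis (2 * pi * m i / h), 1:]"
  have M: "?M \<in> carrier_mat l l" by (simp add: coxeter_mat_def)
  have "exp (2 * of_real pi * \<i> * of_nat (m i) / of_nat h) = cis (2 * pi * m i / h)" for i
    by (simp add: cis_conv_exp mult_ac)
  then have P: "char_poly ?M = ?P" using char_poly p(3) by simp
  interpret cnj: comm_ring_hom cnj by unfold_locales auto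
  have "?M $$ (i, j) \<in> \<real>" if "i < l" "j < l" for i j
  proof -
    have "foldr (coxeter_step l cartan_entry) p (unit_coords j) i \<in> \<real>"
      by (rule foldr_coxeter_step_real) (auto simp: cartan_entry_real l p(2) unit_coords_def)
    then show ?thesis using that by (simp add: coxeter_mat_def)
  qed
  then have "map_mat cnj ?M = ?M"
    using M by (intro eq_matI) (auto simp: Reals_cnj_iff)
  then have "map_poly cnj (char_poly ?M) = char_poly ?M"
    using cnj.char_poly_hom[OF M] by simp
  then have real: "map_poly cnj ?P = ?P" unfolding P .
  have "of_real (2 ^ (2 * l) * (\<Prod>i<l. (sin (real (m i) * pi / (2 * real h)))\<^sup>2)) = poly ?P 1"
    using poly_at_1_eq_prod_sin[OF m real] by simp
  also have "\<dots> = det (1 \<cdot>\<^sub>m 1\<^sub>m l - ?M)"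
    using poly_char_poly[OF M, of 1] P by simp
  also have "1 \<cdot>\<^sub>m 1\<^sub>m l - ?M = 1\<^sub>m l - ?M" using M by (intro eq_matI) auto
  also have "det (1\<^sub>m l - ?M) = det (cartan_matrix H \<alpha>)"
    using det_one_minus_coxeter_mat[OF p(1,2)] cartan_matrix_eq l by metis
  finally show ?thesis .
qed

end
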